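(* Assume that $g\in W_0$ has stable integer shifts and that $\Lambda\subseteq\mathbb{R}$ is relatively separated. The following are equivalent. (a) The family $\mathcal{G}(g,(-\Lambda)\times\mathbb{Z})=\{M_kT_{-\lambda}g:k\in\mathbb{Z},\lambda\in\Lambda\}$ is a frame for $L^2(\mathbb{R})$, i.e., there exist $A,B>0$ such that $$A\|f\|_2^2\le\sum_{k\in\mathbb{Z}}\sum_{\lambda\in\Lambda}|\langle f,M_kT_{-\lambda}g\rangle|^2\le B\|f\|_2^2\quad\text{for all } f\in L^2(\mathbb{R}).\qquad(\mathrm{i})$$ (b) The set $\Lambda+x$ is a sampling set of $V^2(g)$ for every $x\in[0,1)$, i.e., for each $x\in[0,1)$ there exist $A_x,B_x>0$ such that $$A_x\|c\|_2^2\le\sum_{\lambda\in\Lambda}\Big|\sum_{k\in\mathbb{Z}}c_kg(\lambda+x-k)\Big|^2\le B_x\|c\|_2^2\quad\text{for all } c\in\ell^2(\mathbb{Z}).$$ (c) There exist $A,B>0$ such that, for all $x\in[0,1)$, $$A\|c\|_2^2\le\sum_{\lambda\in\Lambda}\Big|\sum_{k\in\mathbb{Z}}c_kg(\lambda+x-k)\Big|^2\le B\|c\|_2^2\quad\text{for all } c\in\ell^2(\mathbb{Z}).\qquad(\mathrm{ii})$$ (d) There exist constants $A,B>0$ such that $$A\|h\|_2^2\le\sum_{\lambda\in\Lambda}\Big|\int_0^1h(\xi)\,Zg(x+\lambda,\xi)\,d\xi\Big|^2\le B\|h\|_2^2\qquad(\mathrm{iii})$$ for all $h\in L^2([0,1])$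 and $x\in[0,1)$. Moreover, the optimal constants in (i), (ii) and (iii) coincide.
   Context: $W_0=W(C,\ell_1)$ is the space of continuous functions $g:\mathbb{R}\to\mathbb{C}$ with $\|g\|_W=\sum_{k\in\mathbb{Z}}\max_{x\in[k,k+1]}|g(x)|<\infty$. For $1\le p\le\infty$, $V^p(g)=\{\sum_{k\in\mathbb{Z}}c_kg(\cdot-k):c\in\ell^p(\mathbb{Z})\}$. $g\in W_0$ has stable integer shifts if it satisfies any of the following equivalent conditions: for some (equivalently all) $p\in[1,\infty]$ there is $C_p>0$ with $\|\sum_kc_kg(\cdot-k)\|_p\ge C_p\|c\|_p$ for all $c\in\ell^p(\mathbb{Z})$; $\sum_kc_kg(\cdot-k)\ne0$ for every $c\in\ell^\infty(\mathbb{Z})\setminus\{0\}$; $\sum_{k\in\mathbb{Z}}|\hat g(\xi+k)|^2>0$ for every $\xi\in\mathbb{R}$, where $\hat g(\xi)=\int_{\mathbb{R}}g(x)e^{-2\pi ix\xi}dx$. A set $\Lambda\subseteq\mathbb{R}$ is relatively separated if $\max_{x\in\mathbb{R}}\#(\Lambda\cap[x,x+1])<\infty$. $T_yg(x)=g(x-y)$, $M_\xi g(x)=e^{2\pi ix\xi}g(x)$. Zak transform: $Zg(x,\xi)=\sum_{k\in\mathbb{Z}}g(x+k)e^{2\pi ik\xi}$. *)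

theory Defs
  imports "HOL-Analysis.Analysis" "HOL-Probability.Essential_Supremum"
begin

text \<open>The L^p norm for 1 \<le> p \<le> \<infinity>, with values in [0, \<infinity>]. Over the counting measure on the
  integers this is the norm of the sequence space.\<close>

definition Lp_norm :: "ennreal \<Rightarrow> 'a measure \<Rightarrow> ('a \<Rightarrow> complex) \<Rightarrow> ennreal" where
  "Lp_norm p M f =
    (if p = \<infinity> then esssup M (\<lambda>x. ennreal (cmod (f x)))
     else let r = enn2real p; I = (\<integral>\<^sup>+ x. ennreal (cmod (f x) powr r) \<partial>M)
          in if I = \<infinity> then \<infinity> else ennreal (enn2real I powr (1 / r)))"

definition Lp_space :: "ennreal \<Rightarrow> 'a measure \<Rightarrow> ('a \<Rightarrow> complex) set" where
  "Lp_space p M = {f \<in> borel_measurable M. Lp_norm p M f < \<infinity>}"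

abbreviation ell_norm :: "ennreal \<Rightarrow> (int \<Rightarrow> complex) \<Rightarrow> ennreal" where
  "ell_norm p \<equiv> Lp_norm p (count_space UNIV)"

abbreviation ell_space :: "ennreal \<Rightarrow> (int \<Rightarrow> complex) set" where
  "ell_space p \<equiv> Lp_space p (count_space UNIV)"

abbreviation unit_interval :: "real measure" where
  "unit_interval \<equiv> restrict_space lborel {0..1}"

definition wiener_space :: "(real \<Rightarrow> complex) set" where
  "wiener_space = {g. continuous_on UNIV g \<and>
     (\<lambda>k::int. SUP x\<in>{of_int k..of_int k + 1}. cmod (g x)) summable_on UNIV}"

text \<open>For c ranging over the p-summable sequences, these are the elements of V^p(g).\<close>

definition shift_series :: "(real \<Rightarrow> complex) \<Rightarrow> (int \<Rightarrow> complex) \<Rightarrow> real \<Rightarrow> complex" where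
  "shift_series g c x = (\<Sum>\<^sub>\<infinity>k. c k * g (x - of_int k))"

text \<open>For g in the Wiener space the lower bound for one exponent p is equivalent to the lower bound
  for all p, to injectivity on bounded sequences, and to the nonvanishing of the periodized
  squared Fourier transform.\<close>

definition stable_integer_shifts :: "(real \<Rightarrow> complex) \<Rightarrow> bool" where
  "stable_integer_shifts g \<longleftrightarrow>
     (\<exists>p\<ge>1. \<exists>C>0. \<forall>c\<in>ell_space p.
        ennreal C * ell_norm p c \<le> Lp_norm p lborel (shift_series g c))"

definition relatively_separated :: "real set \<Rightarrow> bool" where
  "relatively_separated \<Lambda> \<longleftrightarrow>
     (\<exists>N::nat. \<forall>x. finite (\<Lambda> \<inter> {x..x + 1}) \<and> card (\<Lambda> \<inter> {x..x + 1}) \<le> N)"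

definition translation :: "real \<Rightarrow> (real \<Rightarrow> complex) \<Rightarrow> real \<Rightarrow> complex" where
  "translation y g x = g (x - y)"

definition modulation :: "real \<Rightarrow> (real \<Rightarrow> complex) \<Rightarrow> real \<Rightarrow> complex" where
  "modulation \<xi> g x = cis (2 * pi * x * \<xi>) * g x"

definition Zak :: "(real \<Rightarrow> complex) \<Rightarrow> real \<Rightarrow> real \<Rightarrow> complex" where
  "Zak g x \<xi> = (\<Sum>\<^sub>\<infinity>k::int. g (x + of_int k) * cis (2 * pi * of_int k * \<xi>))"

definition L2_inner :: "(real \<Rightarrow> complex) \<Rightarrow> (real \<Rightarrow> complex) \<Rightarrow> complex" where
  "L2_inner f h = (LBINT x. f x * cnj (h x))"

text \<open>The sums of squares below are taken in [0, \<infinity>], so that the upper bounds assert convergence.\<close>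

definition gabor_frame_bounds :: "(real \<Rightarrow> complex) \<Rightarrow> real set \<Rightarrow> real \<Rightarrow> real \<Rightarrow> bool" where
  "gabor_frame_bounds g \<Lambda> A B \<longleftrightarrow> A > 0 \<and> B > 0 \<and>
     (\<forall>f\<in>Lp_space 2 lborel.
        let S = (\<Sum>\<^sub>\<infinity>k::int. \<Sum>\<^sub>\<infinity>l\<in>\<Lambda>.
                  ennreal ((cmod (L2_inner f (modulation (of_int k) (translation (- l) g))))\<^sup>2))
        in ennreal A * (Lp_norm 2 lborel f)\<^sup>2 \<le> S \<and> S \<le> ennreal B * (Lp_norm 2 lborel f)\<^sup>2)"

definition sampling_bounds :: "(real \<Rightarrow> complex) \<Rightarrow> real set \<Rightarrow> real \<Rightarrow> real \<Rightarrow> real \<Rightarrow> bool" where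
  "sampling_bounds g \<Lambda> x A B \<longleftrightarrow> A > 0 \<and> B > 0 \<and>
     (\<forall>c\<in>ell_space 2.
        let S = (\<Sum>\<^sub>\<infinity>l\<in>\<Lambda>. ennreal ((cmod (shift_series g c (l + x)))\<^sup>2))
        in ennreal A * (ell_norm 2 c)\<^sup>2 \<le> S \<and> S \<le> ennreal B * (ell_norm 2 c)\<^sup>2)"

definition uniform_sampling_bounds :: "(real \<Rightarrow> complex) \<Rightarrow> real set \<Rightarrow> real \<Rightarrow> real \<Rightarrow> bool" where
  "uniform_sampling_bounds g \<Lambda> A B \<longleftrightarrow> (\<forall>x\<in>{0..<1}. sampling_bounds g \<Lambda> x A B)"

definition Zak_bounds :: "(real \<Rightarrow> complex) \<Rightarrow> real set \<Rightarrow> real \<Rightarrow> real \<Rightarrow> bool" where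
  "Zak_bounds g \<Lambda> A B \<longleftrightarrow> A > 0 \<and> B > 0 \<and>
     (\<forall>h\<in>Lp_space 2 unit_interval. \<forall>x\<in>{0..<1}.
        let S = (\<Sum>\<^sub>\<infinity>l\<in>\<Lambda>. ennreal ((cmod (LBINT \<xi>:{0..1}. h \<xi> * Zak g (x + l) \<xi>))\<^sup>2))
        in ennreal A * (Lp_norm 2 unit_interval h)\<^sup>2 \<le> S \<and>
           S \<le> ennreal B * (Lp_norm 2 unit_interval h)\<^sup>2)"

text \<open>A is the largest admissible lower bound and B the smallest admissible upper bound;
  such a pair is unique if it exists.\<close>

definition optimal_bounds :: "(real \<Rightarrow> real \<Rightarrow> bool) \<Rightarrow> real \<Rightarrow> real \<Rightarrow> bool" where
  "optimal_bounds P A B \<longleftrightarrow> P A B \<and> (\<forall>A' B'. P A' B' \<longrightarrow> A' \<le> A \<and> B \<le> B')"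

end

theory Submission
  imports Defs
begin

text \<open>Write S(x, c) for the sum over \<Lambda> of the squared samples of the shift series of c at
  translation x. Every condition is compared with the uniform bounds of S(x, c) by multiples of the
  squared norm of c. Parseval on [0, 1], applied to the periodizations of f times a translate of g,
  turns the Gabor sum into the integral over x of S at the fibre of f over x; conversely, functions
  supported near x + \<int> and continuity of S in x recover the bounds at every single x. The Zak sum
  of h is S at the Fourier coefficients of h, and by density it suffices to know S on finitely
  supported sequences. Since translation is continuous in the amalgam norm, Schur's test makes S
  continuous in x, uniformly over the unit ball of c, so pointwise lower bounds become uniform by
  compactness of [0, 1].\<close>

section \<open>Square norms\<close>

text \<open>The optimal constants have to agree, so no comparison may lose a factor. Gabor, uniform
  and Zak bounds are therefore shown to be one and the same relation in \<open>A\<close> and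
  \<open>B\<close>; a single existence proof for an optimal pair then serves all three. Wherever a
  translation or a sequence is perturbed, the square of a sum is split with the weights
  \<open>1 + t\<close> and \<open>1 + 1 / t\<close>. The main term keeps a factor close to 1, the
  large weight falls on an error that is chosen small after \<open>t\<close> is fixed, and
  \<open>t\<close> tends to 0 at the very end. Only the passage from pointwise to uniform bounds may
  waste a constant, because there mere existence is claimed. The obstacle on the Gabor side is that
  the frame inequality sees S only through integrals over x, and fibres of f are square-summable
  only almost everywhere. On the Zak side it is that the test objects are functions h rather than
  sequences: trigonometric polynomials hit the finitely supported sequences exactly, with the same
  constants, and the tail of a general c is paid for by Schur's test.\<close>

definition sq_norm :: "'a measure \<Rightarrow> ('a \<Rightarrow> complex) \<Rightarrow> ennreal" where
  "sq_norm M f = (\<integral>\<^sup>+ x. ennreal ((cmod (f x))\<^sup>2) \<partial>M)"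

lemma Lp_norm_2:
  "Lp_norm 2 M f = (if sq_norm M f = \<infinity> then \<infinity> else ennreal (sqrt (enn2real (sq_norm M f))))"
proof -
  have "enn2real 2 = 2" by (metis enn2real_ennreal ennreal_numeral zero_le_numeral)
  moreover have "(2::ennreal) \<noteq> \<infinity>" by simp
  ultimately show ?thesis
    by (simp add: Lp_norm_def sq_norm_def Let_def powr_half_sqrt del: infinity_ennreal_def)
qed

text \<open>All conditions contain the norm only in squared form. From here on the root and the case
  split inside \<open>Lp_norm\<close> are gone, and every estimate is linear in
  \<open>sq_norm\<close>, infinite values included.\<close>

lemma Lp_norm_2_squared: "(Lp_norm 2 M f)\<^sup>2 = sq_norm M f"
proof (cases "sq_norm M f = \<infinity>")
  case True
  then show ?thesis by (simp add: Lp_norm_2 power2_eq_square ennreal_top_mult)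
next
  case False
  then show ?thesis 
    by (simp add: Lp_norm_2 ennreal_power less_top)
qed

lemma Lp_space_2: "Lp_space 2 M = {f \<in> borel_measurable M. sq_norm M f < \<infinity>}"
  by (auto simp: Lp_space_def Lp_norm_2 less_top[symmetric])

text \<open>The sum is a supremum over finite partial sums. An enumeration exhausts \<open>A\<close>
  by finite sets, and monotone convergence carries the integral to the same supremum. Once sums are
  integrals, Tonelli and Cauchy-Schwarz apply to them.\<close>

lemma countable_infsum_ennreal_eq_nn_integral:
  fixes f :: "'a \<Rightarrow> ennreal"
  assumes "countable A"
  shows "infsum f A = (\<integral>\<^sup>+ x. f x \<partial>count_space A)"
proof (rule antisym)
  have eq: "infsum f A = (SUP F\<in>{F. finite F \<and> F \<subseteq> A}. sum f F)"
    by (rule nonneg_infsum_complete) simp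
  have fin: "sum f F = (\<integral>\<^sup>+ x. f x * indicator F x \<partial>count_space A)" if "finite F" "F \<subseteq> A" for F
    using that by (subst nn_integral_count_space'[where A=F]) (auto intro!: sum.cong)
  show "infsum f A \<le> (\<integral>\<^sup>+ x. f x \<partial>count_space A)"
    unfolding eq
    by (intro SUP_least) (auto simp: fin indicator_def intro!: nn_integral_mono)
  show "(\<integral>\<^sup>+ x. f x \<partial>count_space A) \<le> infsum f A"
  proof (cases "A = {}")
    case False
    define F where "F n = from_nat_into A ` {..n}" for n :: nat
    have F: "finite (F n)" "F n \<subseteq> A" for n
      using False by (auto simp: F_def intro: from_nat_into)
    have mono: "F m \<subseteq> F n" if "m \<le> n" for m n using that by (auto simp: F_def)
    have "(\<integral>\<^sup>+ x. f x \<partial>count_space A) = (\<integral>\<^sup>+ x. (SUP n. f x * indicator (F n) x) \<partial>count_space A)"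
    proof (intro nn_integral_cong antisym)
      fix x assume "x \<in> space (count_space A)"
      then obtain n where "x = from_nat_into A n"
        using assms False by (metis from_nat_into_surj space_count_space)
      then have "f x = f x * indicator (F n) x" by (simp add: F_def)
      then show "f x \<le> (SUP n. f x * indicator (F n) x)"
        by (metis SUP_upper UNIV_I)
      show "(SUP n. f x * indicator (F n) x) \<le> f x"
        by (intro SUP_least) (simp add: indicator_def)
    qed
    also have "\<dots> = (SUP n. \<integral>\<^sup>+ x. f x * indicator (F n) x \<partial>count_space A)"
      using mono
      by (intro nn_integral_monotone_convergence_SUP)
        (auto simp: incseq_def le_fun_def indicator_def)
    also have "\<dots> \<le> infsum f A"
      unfolding eq using F by (intro SUP_least) (auto simp: fin[symmetric] intro!: SUP_upper)
    finally show ?thesis .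
  qed (simp add: nn_integral_empty)
qed

text \<open>For complex terms, summability and absolute summability coincide, and when they fail
  both sides are 0 by convention. Shift series and Zak series may thus be rewritten as integrals
  before convergence is discussed.\<close>

lemma infsum_eq_integral_count_space:
  fixes f :: "'a \<Rightarrow> complex"
  shows "infsum f A = (\<integral> x. f x \<partial>count_space A)"
proof (cases "f summable_on A")
  case True
  then have "Infinite_Set_Sum.abs_summable_on f A"
    by (simp add: abs_summable_equivalent summable_on_iff_abs_summable_on_complex)
  then show ?thesis by (simp add: infsetsum_infsum[symmetric] infsetsum_def)
next
  case False
  then have "\<not> Infinite_Set_Sum.abs_summable_on f A"
    using abs_summable_equivalent summable_on_iff_abs_summable_on_complex by blast
  then have "(\<integral> x. f x \<partial>count_space A) = 0"
    by (simp add: Infinite_Set_Sum.abs_summable_on_def not_integrable_integral_eq)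
  with False show ?thesis by (simp add: infsum_not_exists)
qed

text \<open>The cross term is absorbed by the weighted arithmetic-geometric mean inequality, which
  is the nonnegativity of the square of \<open>t * cmod u - cmod v\<close>. The free weight
  \<open>t\<close> is what preserves sharp constants later.\<close>

lemma cmod_add_squared_le:
  assumes "0 < t"
  shows "(cmod (u + v))\<^sup>2 \<le> (1 + t) * (cmod u)\<^sup>2 + (1 + 1 / t) * (cmod v)\<^sup>2"
proof -
  have "(cmod (u + v))\<^sup>2 \<le> (cmod u + cmod v)\<^sup>2"
    by (simp add: norm_triangle_ineq power_mono)
  also have "\<dots> \<le> (1 + t) * (cmod u)\<^sup>2 + (1 + 1 / t) * (cmod v)\<^sup>2"
  proof -
    have "0 \<le> (t * cmod u - cmod v)\<^sup>2 / t" using assms by simp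
    also have "\<dots> = t * (cmod u)\<^sup>2 + (1 / t) * (cmod v)\<^sup>2 - 2 * cmod u * cmod v"
      using assms by (simp add: power2_eq_square field_simps)
    finally show ?thesis by (simp add: power2_eq_square algebra_simps)
  qed
  finally show ?thesis .
qed

lemma sq_norm_add_le:
  assumes [measurable]: "f \<in> borel_measurable M" "h \<in> borel_measurable M" and t: "0 < t"
  shows "sq_norm M (\<lambda>x. f x + h x) \<le> ennreal (1 + t) * sq_norm M f + ennreal (1 + 1 / t) * sq_norm M h"
proof -
  have "sq_norm M (\<lambda>x. f x + h x) \<le>
      (\<integral>\<^sup>+ x. ennreal (1 + t) * ennreal ((cmod (f x))\<^sup>2) + ennreal (1 + 1 / t) * ennreal ((cmod (h x))\<^sup>2) \<partial>M)"
    unfolding sq_norm_def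
    using cmod_add_squared_le[OF t] t
    by (intro nn_integral_mono) (simp add: ennreal_mult[symmetric] ennreal_plus[symmetric] del: ennreal_plus)
  also have "\<dots> = ennreal (1 + t) * sq_norm M f + ennreal (1 + 1 / t) * sq_norm M h"
    unfolding sq_norm_def by (simp add: nn_integral_add nn_integral_cmult)
  finally show ?thesis .
qed

lemma sq_norm_cnj [simp]: "sq_norm M (\<lambda>x. cnj (f x)) = sq_norm M f"
  by (simp add: sq_norm_def)

section \<open>Parseval's identity on the unit interval\<close>

definition fourier_coeff :: "(real \<Rightarrow> complex) \<Rightarrow> int \<Rightarrow> complex" where
  "fourier_coeff h k = (\<integral>\<xi>. h \<xi> * cis (- (2 * pi * of_int k * \<xi>)) \<partial>unit_interval)"

definition trig_poly :: "(int \<Rightarrow> complex) \<Rightarrow> int set \<Rightarrow> real \<Rightarrow> complex" where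
  "trig_poly c F \<xi> = (\<Sum>k\<in>F. c k * cis (2 * pi * of_int k * \<xi>))"

lemma finite_measure_unit_interval: "finite_measure unit_interval"
  by (rule finite_measureI) (simp add: emeasure_restrict_space space_restrict_space)

interpretation unit_interval: finite_measure unit_interval
  by (rule finite_measure_unit_interval)

lemma sq_norm_finite_imp_integrable:
  assumes [measurable]: "h \<in> borel_measurable M" and "sq_norm M h < \<infinity>" "finite_measure M"
  shows "integrable M h" "integrable M (\<lambda>x. (cmod (h x))\<^sup>2)"
proof -
  show sq: "integrable M (\<lambda>x. (cmod (h x))\<^sup>2)"
    using assms(2) by (intro integrableI_bounded) (auto simp: sq_norm_def)
  interpret finite_measure M by fact
  show "integrable M h"
  proof (rule Bochner_Integration.integrable_bound)
    show "integrable M (\<lambda>x. 1 + (cmod (h x))\<^sup>2)" using sq by simp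
    have "cmod z \<le> 1 + (cmod z)\<^sup>2" for z
      by (smt (verit) power2_eq_square mult_left_le_one_le norm_ge_zero self_le_power zero_less_numeral zero_le_power2)
    then show "AE x in M. norm (h x) \<le> norm (1 + (cmod (h x))\<^sup>2)"
      by (auto simp: abs_of_nonneg)
  qed simp
qed

lemma sq_norm_eq_integral:
  assumes [measurable]: "h \<in> borel_measurable M" and "sq_norm M h < \<infinity>"
  shows "sq_norm M h = ennreal (\<integral>x. (cmod (h x))\<^sup>2 \<partial>M)"
  unfolding sq_norm_def
  using assms(2) by (intro nn_integral_eq_integral integrableI_bounded) (auto simp: sq_norm_def)

lemma measurable_unit_interval: "continuous_on UNIV f \<Longrightarrow> f \<in> borel_measurable unit_interval"
  for f :: "real \<Rightarrow> complex"
  by (intro measurable_restrict_space1) (simp add: borel_measurable_continuous_onI)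

lemma cis_measurable [measurable]: "(\<lambda>x. cis (a * x)) \<in> borel_measurable unit_interval"
  by (intro measurable_unit_interval continuous_intros)

lemma integral_cis_unit_interval:
  "(\<integral>\<xi>. cis (2 * pi * of_int k * \<xi>) \<partial>unit_interval) = (if k = 0 then 1 else 0)"
proof (cases "k = 0")
  case True
  then show ?thesis by (simp add: measure_restrict_space space_restrict_space)
next
  case False
  define w where "w = 2 * pi * real_of_int k"
  have w: "w \<noteq> 0" using False by (simp add: w_def)
  have "(\<integral>\<xi>. cis (w * \<xi>) \<partial>unit_interval) = (LBINT \<xi>. indicator {0..1} \<xi> *\<^sub>R cis (w * \<xi>))"
    by (simp add: integral_restrict_space)
  also have "\<dots> = cis (w * 1) / (\<i> * w) - cis (w * 0) / (\<i> * w)"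
  proof (rule integral_FTC_Icc)
    fix x :: real
    show "((\<lambda>x. cis (w * x) / (\<i> * w)) has_vector_derivative cis (w * x)) (at x within {0..1})"
    proof -
      have "((\<lambda>z. exp (\<i> * w * z) / (\<i> * w)) has_field_derivative exp (\<i> * w * of_real x)) (at (of_real x))"
        using w by (auto intro!: derivative_eq_intros)
      from has_vector_derivative_real_field[OF this] show ?thesis
        by (simp add: cis_conv_exp mult.assoc)
    qed
  qed (auto intro!: continuous_intros)
  also have "cis (w * 1) = 1" unfolding w_def by (simp add: cis_multiple_2pi)
  finally show ?thesis using False by (simp add: w_def)
qed

lemma continuous_trig_poly: "continuous_on A (trig_poly c F)"
  unfolding trig_poly_def[abs_def] by (intro continuous_intros)

lemma measurable_trig_poly [measurable]: "trig_poly c F \<in> borel_measurable unit_interval"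
  by (intro measurable_unit_interval continuous_trig_poly)

lemma integrable_mult_cis:
  assumes "integrable unit_interval h"
  shows "integrable unit_interval (\<lambda>\<xi>. h \<xi> * cis (a * \<xi>))"
  using borel_measurable_integrable[OF assms]
  by (intro Bochner_Integration.integrable_bound[OF assms]) (auto simp: norm_mult)

text \<open>Orthonormality of the exponentials. Besides Parseval, this supplies the test functions
  for the Zak condition: every finitely supported sequence is the coefficient sequence of a bounded
  function.\<close>

lemma fourier_coeff_trig_poly:
  assumes "finite F"
  shows "fourier_coeff (trig_poly c F) k = (if k \<in> F then c k else 0)"
proof -
  have int: "integrable unit_interval (\<lambda>\<xi>. cis (a * \<xi>))" for a
    using integrable_mult_cis[of "\<lambda>_. 1"] by simp
  have "fourier_coeff (trig_poly c F) k =
      (\<integral>\<xi>. (\<Sum>j\<in>F. c j * cis (2 * pi * of_int (j - k) * \<xi>)) \<partial>unit_interval)"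
    unfolding fourier_coeff_def trig_poly_def sum_distrib_right
    by (intro Bochner_Integration.integral_cong sum.cong refl)
      (simp add: mult.assoc cis_mult, simp add: algebra_simps)
  also have "\<dots> = (\<Sum>j\<in>F. c j * (\<integral>\<xi>. cis (2 * pi * of_int (j - k) * \<xi>) \<partial>unit_interval))"
    by (subst Bochner_Integration.integral_sum) (simp_all add: int)
  also have "\<dots> = (\<Sum>j\<in>F. if j = k then c k else 0)"
    unfolding integral_cis_unit_interval by (intro sum.cong) auto
  finally show ?thesis using assms by simp
qed

lemma integral_mult_cnj_trig_poly:
  assumes "integrable unit_interval h"
  shows "(\<integral>\<xi>. h \<xi> * cnj (trig_poly c F \<xi>) \<partial>unit_interval) = (\<Sum>k\<in>F. cnj (c k) * fourier_coeff h k)"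
    and "integrable unit_interval (\<lambda>\<xi>. h \<xi> * cnj (trig_poly c F \<xi>))"
proof -
  have eq: "h \<xi> * cnj (trig_poly c F \<xi>) = (\<Sum>k\<in>F. cnj (c k) * (h \<xi> * cis ((- (2 * pi * of_int k)) * \<xi>)))" for \<xi>
    by (simp add: trig_poly_def cnj_sum sum_distrib_left cis_cnj algebra_simps)
  note int = integrable_mult_cis[OF assms]
  show "integrable unit_interval (\<lambda>\<xi>. h \<xi> * cnj (trig_poly c F \<xi>))"
    unfolding eq by (intro Bochner_Integration.integrable_sum integrable_mult_right int)
  show "(\<integral>\<xi>. h \<xi> * cnj (trig_poly c F \<xi>) \<partial>unit_interval) = (\<Sum>k\<in>F. cnj (c k) * fourier_coeff h k)"
    unfolding eq
    by (subst Bochner_Integration.integral_sum)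
      (rule integrable_mult_right[OF int], simp add: fourier_coeff_def)
qed

text \<open>Completing the square for orthonormal exponentials. Choosing \<open>c\<close> as the
  Fourier coefficients kills the last sum and leaves Bessel's inequality; for a good approximant,
  dropping the last sum bounds the defect in Bessel's inequality. Both halves of
  \<open>Parseval\<close> come from this identity.\<close>

lemma integral_norm_diff_trig_poly:
  assumes [measurable]: "h \<in> borel_measurable unit_interval" and h: "sq_norm unit_interval h < \<infinity>"
    and F: "finite F"
  shows "(\<integral>\<xi>. (cmod (h \<xi> - trig_poly c F \<xi>))\<^sup>2 \<partial>unit_interval) =
    (\<integral>\<xi>. (cmod (h \<xi>))\<^sup>2 \<partial>unit_interval) - (\<Sum>k\<in>F. (cmod (fourier_coeff h k))\<^sup>2)
      + (\<Sum>k\<in>F. (cmod (fourier_coeff h k - c k))\<^sup>2)"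
proof -
  let ?U = unit_interval and ?p = "trig_poly c F"
  note hi = sq_norm_finite_imp_integrable[OF assms(1) h finite_measure_unit_interval]
  have hh: "integrable ?U (\<lambda>\<xi>. h \<xi> * cnj (h \<xi>))"
    "(\<integral>\<xi>. h \<xi> * cnj (h \<xi>) \<partial>?U) = of_real (\<integral>\<xi>. (cmod (h \<xi>))\<^sup>2 \<partial>?U)"
    using integrable_of_real[OF hi(2), where ?'a = complex]
    unfolding complex_norm_square integral_complex_of_real[symmetric] by simp_all
  have pint: "integrable ?U ?p"
    using integrable_mult_cis[of "\<lambda>_. 1"] unfolding trig_poly_def[abs_def]
    by (intro Bochner_Integration.integrable_sum integrable_mult_right) simp
  note hp = integral_mult_cnj_trig_poly[OF hi(1), of c F]
  note pp = integral_mult_cnj_trig_poly[OF pint, of c F]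
  \<comment> \<open>The computation runs in the complex numbers, where the squared modulus is a
    product and linearity of the integral applies; injectivity of \<open>of_real\<close> brings it
    back.\<close>
  have "of_real (\<integral>\<xi>. (cmod (h \<xi> - ?p \<xi>))\<^sup>2 \<partial>?U) =
      (\<integral>\<xi>. h \<xi> * cnj (h \<xi>) - h \<xi> * cnj (?p \<xi>) - cnj (h \<xi> * cnj (?p \<xi>)) + ?p \<xi> * cnj (?p \<xi>) \<partial>?U)"
    unfolding integral_complex_of_real[symmetric] complex_norm_square
    by (intro Bochner_Integration.integral_cong) (simp_all add: algebra_simps)
  also have "\<dots> = (\<integral>\<xi>. h \<xi> * cnj (h \<xi>) \<partial>?U) - (\<integral>\<xi>. h \<xi> * cnj (?p \<xi>) \<partial>?U)
      - cnj (\<integral>\<xi>. h \<xi> * cnj (?p \<xi>) \<partial>?U) + (\<integral>\<xi>. ?p \<xi> * cnj (?p \<xi>) \<partial>?U)"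
    using hh hp pp integrable_cnj[OF hp(2)]
    by (simp add: integral_cnj[symmetric] del: complex_cnj_mult)
  also have "\<dots> = of_real ((\<integral>\<xi>. (cmod (h \<xi>))\<^sup>2 \<partial>?U) - (\<Sum>k\<in>F. (cmod (fourier_coeff h k))\<^sup>2)
      + (\<Sum>k\<in>F. (cmod (fourier_coeff h k - c k))\<^sup>2))"
    unfolding hh hp pp of_real_add of_real_diff of_real_sum complex_norm_square
    by (simp add: fourier_coeff_trig_poly[OF F] sum_subtractf sum.distrib algebra_simps)
  finally show ?thesis by (simp only: of_real_eq_iff)
qed

section \<open>Density of trigonometric polynomials in mean square\<close>

definition trig_approx :: "(real \<Rightarrow> complex) \<Rightarrow> bool" where
  "trig_approx h \<longleftrightarrow> h \<in> borel_measurable unit_interval \<and>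
     (\<forall>\<epsilon>>0. \<exists>c F. finite F \<and> sq_norm unit_interval (\<lambda>\<xi>. h \<xi> - trig_poly c F \<xi>) \<le> ennreal \<epsilon>)"

text \<open>Closure under mean-square limits lets the approximation proceed in stages: continuous
  functions with equal end values, bounded measurable functions, square-integrable
  functions.\<close>

lemma trig_approx_limit:
  assumes f: "\<And>n::nat. trig_approx (f n)"
    and [measurable]: "h \<in> borel_measurable unit_interval"
    and lim: "(\<lambda>n. sq_norm unit_interval (\<lambda>\<xi>. h \<xi> - f n \<xi>)) \<longlonglongrightarrow> 0"
  shows "trig_approx h"
  unfolding trig_approx_def
proof (intro conjI allI impI)
  fix \<epsilon> :: real assume \<epsilon>: "0 < \<epsilon>"
  have [measurable]: "f n \<in> borel_measurable unit_interval" for n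
    using f by (simp add: trig_approx_def)
  \<comment> \<open>The split with \<open>t = 1\<close> doubles both squared errors, so each of them
    gets a quarter of \<epsilon>.\<close>
  have "eventually (\<lambda>n. sq_norm unit_interval (\<lambda>\<xi>. h \<xi> - f n \<xi>) < ennreal (\<epsilon> / 4)) sequentially"
    using \<epsilon> by (intro order_tendstoD(2)[OF lim]) simp
  then obtain n where n: "sq_norm unit_interval (\<lambda>\<xi>. h \<xi> - f n \<xi>) < ennreal (\<epsilon> / 4)"
    by (auto dest: eventually_happens)
  obtain c F where F: "finite F"
    and c: "sq_norm unit_interval (\<lambda>\<xi>. f n \<xi> - trig_poly c F \<xi>) \<le> ennreal (\<epsilon> / 4)"
    using f[of n] \<epsilon> unfolding trig_approx_def by (meson divide_pos_pos zero_less_numeral)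
  have "sq_norm unit_interval (\<lambda>\<xi>. h \<xi> - trig_poly c F \<xi>) =
      sq_norm unit_interval (\<lambda>\<xi>. (h \<xi> - f n \<xi>) + (f n \<xi> - trig_poly c F \<xi>))" by simp
  also have "\<dots> \<le> ennreal (1 + 1) * sq_norm unit_interval (\<lambda>\<xi>. h \<xi> - f n \<xi>)
      + ennreal (1 + 1 / 1) * sq_norm unit_interval (\<lambda>\<xi>. f n \<xi> - trig_poly c F \<xi>)"
    by (intro sq_norm_add_le) simp_all
  also have "\<dots> \<le> ennreal (1 + 1) * ennreal (\<epsilon> / 4) + ennreal (1 + 1 / 1) * ennreal (\<epsilon> / 4)"
    using n c by (intro add_mono mult_left_mono) auto
  also have "\<dots> = ennreal \<epsilon>"
    using \<epsilon> by (simp add: ennreal_numeral[symmetric] ennreal_mult[symmetric] ennreal_plus[symmetric]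
        del: ennreal_numeral ennreal_plus)
  finally show "\<exists>c F. finite F \<and> sq_norm unit_interval (\<lambda>\<xi>. h \<xi> - trig_poly c F \<xi>) \<le> ennreal \<epsilon>"
    using F by blast
qed fact

definition is_trig_poly :: "(real \<Rightarrow> complex) \<Rightarrow> bool" where
  "is_trig_poly f \<longleftrightarrow> (\<exists>c F. finite F \<and> f = trig_poly c F)"

lemma trig_poly_eq_sum_superset:
  assumes "finite G" "F \<subseteq> G"
  shows "trig_poly c F = trig_poly (\<lambda>k. if k \<in> F then c k else 0) G"
  unfolding trig_poly_def[abs_def] using assms
  by (intro ext sum.mono_neutral_cong_left) auto

lemma is_trig_poly_monom: "is_trig_poly (\<lambda>\<xi>. a * cis (2 * pi * of_int k * \<xi>))"
  unfolding is_trig_poly_def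
  by (intro exI[of _ "\<lambda>_. a"] exI[of _ "{k}"]) (simp add: trig_poly_def[abs_def])

lemma is_trig_poly_const: "is_trig_poly (\<lambda>\<xi>. a)"
  using is_trig_poly_monom[of a 0] by simp

lemma is_trig_poly_add:
  assumes "is_trig_poly f" "is_trig_poly h"
  shows "is_trig_poly (\<lambda>\<xi>. f \<xi> + h \<xi>)"
proof -
  obtain c F d G where fin: "finite F" "finite G" and eq: "f = trig_poly c F" "h = trig_poly d G"
    using assms unfolding is_trig_poly_def by blast
  define c' where "c' k = (if k \<in> F then c k else 0)" for k
  define d' where "d' k = (if k \<in> G then d k else 0)" for k
  have "f = trig_poly c' (F \<union> G)" "h = trig_poly d' (F \<union> G)"
    unfolding eq c'_def d'_def using fin by (auto intro!: trig_poly_eq_sum_superset)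
  then have "(\<lambda>\<xi>. f \<xi> + h \<xi>) = trig_poly (\<lambda>k. c' k + d' k) (F \<union> G)"
    by (simp add: trig_poly_def[abs_def] sum.distrib algebra_simps)
  with fin show ?thesis unfolding is_trig_poly_def by blast
qed

lemma is_trig_poly_sum:
  assumes "\<And>i. i \<in> I \<Longrightarrow> is_trig_poly (f i)"
  shows "is_trig_poly (\<lambda>\<xi>. \<Sum>i\<in>I. f i \<xi>)"
  using assms
  by (induction I rule: infinite_finite_induct) (auto intro: is_trig_poly_const is_trig_poly_add)

lemma is_trig_poly_mult:
  assumes "is_trig_poly f" "is_trig_poly h"
  shows "is_trig_poly (\<lambda>\<xi>. f \<xi> * h \<xi>)"
proof -
  obtain c F d G where fin: "finite F" "finite G" and eq: "f = trig_poly c F" "h = trig_poly d G"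
    using assms unfolding is_trig_poly_def by blast
  have "(\<lambda>\<xi>. f \<xi> * h \<xi>) = (\<lambda>\<xi>. \<Sum>j\<in>F. \<Sum>k\<in>G. c j * d k * cis (2 * pi * of_int (j + k) * \<xi>))"
    unfolding eq trig_poly_def[abs_def] sum_product
    by (intro ext sum.cong refl) (simp add: algebra_simps flip: cis_mult)
  then show ?thesis by (simp only:) (intro is_trig_poly_sum is_trig_poly_monom)
qed

text \<open>Sums and products are covered by closure of trigonometric polynomials, so a real-linear
  functional is the only real case: on the circle it equals
  \<open>cos t * f 1 + sin t * f \<i>\<close>, and Euler's formula turns this into frequencies 1 and
  -1.\<close>

lemma is_trig_poly_real_polynomial:
  fixes p :: "complex \<Rightarrow> real"
  assumes "real_polynomial_function p"
  shows "is_trig_poly (\<lambda>\<xi>. of_real (p (cis (2 * pi * \<xi>))))"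
  using assms
proof induction
  case (linear f)
  interpret bounded_linear f by fact
  have "complex_of_real (f (cis t)) = (of_real (f 1) - \<i> * of_real (f \<i>)) / 2 * cis t
      + (of_real (f 1) + \<i> * of_real (f \<i>)) / 2 * cis (- t)" for t
  proof -
    have "f (cis t) = f (cos t *\<^sub>R 1 + sin t *\<^sub>R \<i>)" 
      by (rule arg_cong[where f=f]) (simp add: complex_eq_iff)
    also have "\<dots> = cos t * f 1 + sin t * f \<i>" by (simp add: add scaleR)
    finally show ?thesis by (simp add: complex_eq_iff field_simps)
  qed
  moreover have "is_trig_poly (\<lambda>\<xi>. (of_real (f 1) - \<i> * of_real (f \<i>)) / 2 * cis (2 * pi * of_int 1 * \<xi>)
      + (of_real (f 1) + \<i> * of_real (f \<i>)) / 2 * cis (2 * pi * of_int (-1) * \<xi>))"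
    by (intro is_trig_poly_add is_trig_poly_monom)
  ultimately show ?case by simp
qed (auto intro: is_trig_poly_const is_trig_poly_add is_trig_poly_mult)

lemma is_trig_poly_polynomial:
  fixes p :: "complex \<Rightarrow> complex"
  assumes "polynomial_function p"
  shows "is_trig_poly (\<lambda>\<xi>. p (cis (2 * pi * \<xi>)))"
proof -
  have "real_polynomial_function (\<lambda>x. Re (p x))" "real_polynomial_function (\<lambda>x. Im (p x))"
    using assms bounded_linear_Re bounded_linear_Im by (auto simp: polynomial_function_def comp_def)
  then have "is_trig_poly (\<lambda>\<xi>. of_real (Re (p (cis (2 * pi * \<xi>)))) + \<i> * of_real (Im (p (cis (2 * pi * \<xi>)))))"
    by (intro is_trig_poly_add is_trig_poly_mult[OF is_trig_poly_const] is_trig_poly_real_polynomial[of "\<lambda>x. Re (p x)"]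
        is_trig_poly_real_polynomial[of "\<lambda>x. Im (p x)"])
  then show ?thesis by (simp flip: complex_eq)
qed

text \<open>Equal end values let \<open>f\<close> descend to the unit circle. There
  Stone-Weierstrass gives a uniformly close polynomial, whose restriction to the circle is a
  trigonometric polynomial.\<close>

lemma trig_approx_continuous:
  assumes f: "continuous_on UNIV f" and f01: "f 0 = f 1"
  shows "trig_approx f"
  unfolding trig_approx_def
proof (intro conjI allI impI measurable_unit_interval f)
  fix \<epsilon> :: real assume \<epsilon>: "0 < \<epsilon>"
  \<comment> \<open>Viewing \<open>f\<close> as a loop homotopic to itself yields the continuity of
    \<open>f\<close> composed with the normalized argument. The jump of \<open>Arg2pi\<close> across
    the positive axis does no harm, since the end values agree.\<close>
  have "homotopic_loops UNIV f f"
    using f f01 by (auto simp: homotopic_loops_refl path_def pathstart_def pathfinish_def intro: continuous_on_subset)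
  from homotopic_with_imp_continuous[OF homotopic_loops_imp_homotopic_circlemaps[OF this]]
  have "continuous_on (sphere 0 1) (f \<circ> (\<lambda>z. Arg2pi z / (2 * pi)))" by auto
  moreover have "0 < sqrt \<epsilon>" using \<epsilon> by simp
  ultimately obtain p where p: "polynomial_function p"
    and close: "\<And>z. z \<in> sphere 0 1 \<Longrightarrow> norm ((f \<circ> (\<lambda>z. Arg2pi z / (2 * pi))) z - p z) < sqrt \<epsilon>"
    using Stone_Weierstrass_polynomial_function[OF compact_sphere] by metis
  obtain c F where F: "finite F" and eq: "(\<lambda>\<xi>. p (cis (2 * pi * \<xi>))) = trig_poly c F"
    using is_trig_poly_polynomial[OF p] by (auto simp: is_trig_poly_def)
  have close': "cmod (f \<xi> - trig_poly c F \<xi>) \<le> sqrt \<epsilon>" if "\<xi> \<in> {0..1}" for \<xi>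
  proof -
    have "f (Arg2pi (cis (2 * pi * \<xi>)) / (2 * pi)) = f \<xi>"
    \<comment> \<open>At \<xi> = 1 the point on the circle is 1, whose argument is 0 and not
      \<open>2 * pi\<close>; the value is recovered from \<open>f 0 = f 1\<close>.\<close>
    proof (cases "\<xi> = 1")
      case True
      then show ?thesis using f01 by (simp add: Arg2pi_of_real[of 1, simplified])
    next
      case False
      then have "Arg2pi (cis (2 * pi * \<xi>)) = 2 * pi * \<xi>"
        using that by (intro Arg2pi_unique[of 1]) (auto simp: cis_conv_exp)
      then show ?thesis by simp
    qed
    then show ?thesis using close[of "cis (2 * pi * \<xi>)"] by (simp add: eq[symmetric])
  qed
  have "sq_norm unit_interval (\<lambda>\<xi>. f \<xi> - trig_poly c F \<xi>) \<le> (\<integral>\<^sup>+\<xi>. ennreal \<epsilon> \<partial>unit_interval)"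
    unfolding sq_norm_def
  proof (intro nn_integral_mono ennreal_leI)
    fix \<xi> assume "\<xi> \<in> space unit_interval"
    then have "cmod (f \<xi> - trig_poly c F \<xi>) \<le> sqrt \<epsilon>" by (intro close') (simp add: space_restrict_space)
    then have "(cmod (f \<xi> - trig_poly c F \<xi>))\<^sup>2 \<le> (sqrt \<epsilon>)\<^sup>2" by (intro power_mono) auto
    then show "(cmod (f \<xi> - trig_poly c F \<xi>))\<^sup>2 \<le> \<epsilon>" using \<epsilon> by simp
  qed
  also have "\<dots> = ennreal \<epsilon>" by (simp add: emeasure_restrict_space space_restrict_space)
  finally show "\<exists>c F. finite F \<and> sq_norm unit_interval (\<lambda>\<xi>. f \<xi> - trig_poly c F \<xi>) \<le> ennreal \<epsilon>"
    using F by blast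
qed

lemma AE_unit_interval_iff:
  "(AE \<xi> in unit_interval. P \<xi>) \<longleftrightarrow> (AE \<xi> in lborel. \<xi> \<in> {0..1} \<longrightarrow> P \<xi>)"
  by (subst AE_restrict_space_iff) auto

text \<open>Measurability provides continuous functions converging to \<open>h\<close> off a
  negligible set, but they may be unbounded and have different end values. The nearest-point
  projection \<open>cl\<close> onto the ball of radius \<open>b\<close> restores the bound, a cutoff
  restores equal end values, and dominated convergence finishes.\<close>

lemma trig_approx_bounded:
  assumes [measurable]: "h \<in> borel_measurable unit_interval"
    and b: "\<And>\<xi>. cmod (h \<xi>) \<le> b"
  shows "trig_approx h"
proof -
  have b0: "0 \<le> b" using b[of 0] norm_ge_zero order_trans by blast
  have "h \<in> borel_measurable (lebesgue_on {0..1})"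
    using assms(1) by (simp add: borel_measurable_restrict_space_iff measurable_completion)
  then have "h measurable_on {0..1}"
    by (simp add: measurable_on_iff_borel_measurable)
  then obtain N f where N: "negligible N" and f: "\<And>n. continuous_on UNIV (f n)"
    and lim: "\<And>\<xi>. \<xi> \<notin> N \<Longrightarrow> (\<lambda>n. f n \<xi>) \<longlonglongrightarrow> (if \<xi> \<in> {0..1} then h \<xi> else 0)"
    unfolding measurable_on_def by metis
  define cl where "cl = closest_point (cball (0::complex) b)"
  have cl: "continuous_on UNIV cl" "cl (h \<xi>) = h \<xi>" "cmod (cl z) \<le> b" for \<xi> z
  proof -
    show "continuous_on UNIV cl"
      unfolding cl_def using b0 by (intro continuous_on_closest_point) auto
    show "cl (h \<xi>) = h \<xi>" unfolding cl_def using b by (intro closest_point_self) simp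
    have "cl z \<in> cball 0 b" unfolding cl_def using b0 by (intro closest_point_in_set) auto
    then show "cmod (cl z) \<le> b" by simp
  qed
  \<comment> \<open>The cutoff vanishes at 0 and 1 and is eventually 1 at each interior point.
    Outside the unit interval the product is negative, hence the \<open>max 0\<close> in
    \<open>f'\<close>.\<close>
  define r where "r n \<xi> = min 1 (real n * (\<xi> * (1 - \<xi>)))" for n \<xi>
  define f' where "f' n \<xi> = of_real (max 0 (r n \<xi>)) * cl (f n \<xi>)" for n \<xi>
  have cont: "continuous_on UNIV (f' n)" for n
    unfolding f'_def r_def
    by (intro continuous_intros continuous_on_compose2[OF cl(1)] f) auto
  show ?thesis
  proof (rule trig_approx_limit)
    show "trig_approx (f' n)" for n
      by (intro trig_approx_continuous cont) (simp add: f'_def r_def)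
    have [measurable]: "f' n \<in> borel_measurable unit_interval" for n
      by (intro measurable_unit_interval cont)
    have bd: "cmod (h \<xi> - f' n \<xi>) \<le> 2 * b" for n \<xi>
    proof -
      have "cmod (f' n \<xi>) \<le> 1 * b"
        unfolding f'_def norm_mult using cl(3) by (intro mult_mono) (auto simp: r_def)
      then show ?thesis using b[of \<xi>] norm_triangle_ineq4[of "h \<xi>" "f' n \<xi>"] by simp
    qed
    have "(\<lambda>n. sq_norm unit_interval (\<lambda>\<xi>. h \<xi> - f' n \<xi>)) \<longlonglongrightarrow> (\<integral>\<^sup>+\<xi>. 0 \<partial>unit_interval)"
      unfolding sq_norm_def
    proof (rule nn_integral_dominated_convergence)
      show "AE \<xi> in unit_interval. ennreal ((cmod (h \<xi> - f' n \<xi>))\<^sup>2) \<le> ennreal ((2 * b)\<^sup>2)" for n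
        using bd by (intro AE_I2 ennreal_leI power_mono) auto
      show "(\<integral>\<^sup>+\<xi>. ennreal ((2 * b)\<^sup>2) \<partial>unit_interval) < \<infinity>"
        by (simp add: emeasure_restrict_space space_restrict_space)
      have "AE \<xi> in lebesgue. \<xi> \<notin> N \<union> {0, 1}"
        using N by (intro AE_not_in) (auto simp: negligible_iff_null_sets[symmetric])
      then have "AE \<xi> in lborel. \<xi> \<notin> N \<union> {0, 1}" by (simp add: AE_completion_iff)
      then show "AE \<xi> in unit_interval. (\<lambda>n. ennreal ((cmod (h \<xi> - f' n \<xi>))\<^sup>2)) \<longlonglongrightarrow> 0"
        unfolding AE_unit_interval_iff
      proof eventually_elim
        fix \<xi> assume \<xi>: "\<xi> \<notin> N \<union> {0, 1}"
        show "\<xi> \<in> {0..1} \<longrightarrow> (\<lambda>n. ennreal ((cmod (h \<xi> - f' n \<xi>))\<^sup>2)) \<longlonglongrightarrow> 0"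
        proof
          assume "\<xi> \<in> {0..1}"
          then have "0 < \<xi> * (1 - \<xi>)" using \<xi> by auto
          moreover obtain m :: nat where m: "1 / (\<xi> * (1 - \<xi>)) \<le> m"
            using real_arch_simple by blast
          ultimately have "r n \<xi> = 1" if "n \<ge> m" for n
          proof -
            have "1 / (\<xi> * (1 - \<xi>)) \<le> n" using m that by linarith
            then show ?thesis using \<open>0 < \<xi> * (1 - \<xi>)\<close> by (simp add: r_def min_def field_simps)
          qed
          then have "eventually (\<lambda>n. cl (f n \<xi>) = f' n \<xi>) sequentially"
            unfolding eventually_sequentially f'_def by (intro exI[of _ m]) simp
          moreover have "(\<lambda>n. cl (f n \<xi>)) \<longlonglongrightarrow> cl (h \<xi>)"
            using lim[of \<xi>] \<xi> \<open>\<xi> \<in> {0..1}\<close> 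
            by (intro continuous_on_tendsto_compose[OF cl(1)]) auto
          ultimately have "(\<lambda>n. f' n \<xi>) \<longlonglongrightarrow> cl (h \<xi>)"
            by (rule Lim_transform_eventually[rotated])
          then have "(\<lambda>n. f' n \<xi>) \<longlonglongrightarrow> h \<xi>" by (simp only: cl(2))
          then have "(\<lambda>n. ennreal ((cmod (h \<xi> - f' n \<xi>))\<^sup>2)) \<longlonglongrightarrow> ennreal ((cmod (h \<xi> - h \<xi>))\<^sup>2)"
            by (intro tendsto_intros)
          then show "(\<lambda>n. ennreal ((cmod (h \<xi> - f' n \<xi>))\<^sup>2)) \<longlonglongrightarrow> 0" by simp
        qed
      qed
    qed simp_all
    then show "(\<lambda>n. sq_norm unit_interval (\<lambda>\<xi>. h \<xi> - f' n \<xi>)) \<longlonglongrightarrow> 0" by simp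
  qed fact
qed

text \<open>Truncation by size: the part of \<open>h\<close> above level n is dominated by
  \<open>h\<close> itself and vanishes pointwise for large n.\<close>

lemma trig_approx_L2:
  assumes [measurable]: "h \<in> borel_measurable unit_interval"
    and fin: "sq_norm unit_interval h < \<infinity>"
  shows "trig_approx h"
proof (rule trig_approx_limit)
  define f where "f n \<xi> = (if cmod (h \<xi>) \<le> real n then h \<xi> else 0)" for n \<xi>
  have [measurable]: "f n \<in> borel_measurable unit_interval" for n
    unfolding f_def by measurable
  show "trig_approx (f n)" for n
    by (rule trig_approx_bounded[of _ n]) (auto simp: f_def)
  have "(\<lambda>n. sq_norm unit_interval (\<lambda>\<xi>. h \<xi> - f n \<xi>)) \<longlonglongrightarrow> (\<integral>\<^sup>+\<xi>. 0 \<partial>unit_interval)"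
    unfolding sq_norm_def
  proof (rule nn_integral_dominated_convergence[where w = "\<lambda>\<xi>. ennreal ((cmod (h \<xi>))\<^sup>2)"])
    show "AE \<xi> in unit_interval. (\<lambda>n. ennreal ((cmod (h \<xi> - f n \<xi>))\<^sup>2)) \<longlonglongrightarrow> 0"
    proof (rule AE_I2)
      fix \<xi> :: real
      obtain m :: nat where "cmod (h \<xi>) \<le> m" using real_arch_simple by blast
      then have "h \<xi> - f n \<xi> = 0" if "n \<ge> m" for n using that by (auto simp: f_def)
      then show "(\<lambda>n. ennreal ((cmod (h \<xi> - f n \<xi>))\<^sup>2)) \<longlonglongrightarrow> 0"
        by (intro tendsto_eventually eventually_sequentiallyI[of m]) simp
    qed
  qed (use fin in \<open>auto simp: f_def sq_norm_def\<close>)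
  then show "(\<lambda>n. sq_norm unit_interval (\<lambda>\<xi>. h \<xi> - f n \<xi>)) \<longlonglongrightarrow> 0" by simp
qed fact

theorem Parseval:
  assumes h [measurable]: "h \<in> borel_measurable unit_interval"
    and fin: "sq_norm unit_interval h < \<infinity>"
  shows "sq_norm (count_space UNIV) (fourier_coeff h) = sq_norm unit_interval h"
proof (rule antisym)
  let ?I = "\<integral>\<xi>. (cmod (h \<xi>))\<^sup>2 \<partial>unit_interval"
  let ?S = "\<lambda>F. \<Sum>k\<in>F. (cmod (fourier_coeff h k))\<^sup>2"
  have eq: "sq_norm unit_interval h = ennreal ?I"
    by (rule sq_norm_eq_integral[OF h fin])
  have sup: "sq_norm (count_space UNIV) (fourier_coeff h) =
      (SUP F\<in>{F. finite F \<and> F \<subseteq> UNIV}. \<Sum>k\<in>F. ennreal ((cmod (fourier_coeff h k))\<^sup>2))"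
    unfolding sq_norm_def
    by (rule trans[OF countable_infsum_ennreal_eq_nn_integral[symmetric] nonneg_infsum_complete]) simp_all
  have "?S F \<le> ?I" if "finite F" for F
    using integral_norm_diff_trig_poly[OF h fin that, of "fourier_coeff h"]
      Bochner_Integration.integral_nonneg[of unit_interval "\<lambda>\<xi>. (cmod (h \<xi> - trig_poly (fourier_coeff h) F \<xi>))\<^sup>2"]
    by simp
  then show "sq_norm (count_space UNIV) (fourier_coeff h) \<le> sq_norm unit_interval h"
    unfolding sup eq by (intro SUP_least) (simp add: ennreal_leI)
  show "sq_norm unit_interval h \<le> sq_norm (count_space UNIV) (fourier_coeff h)"
  proof (rule ennreal_le_epsilon)
    fix e :: real assume e: "0 < e"
    obtain c F where F: "finite F"
      and c: "sq_norm unit_interval (\<lambda>\<xi>. h \<xi> - trig_poly c F \<xi>) \<le> ennreal e"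
      using trig_approx_L2[OF h fin] e unfolding trig_approx_def by blast
    have "ennreal (\<integral>\<xi>. (cmod (h \<xi> - trig_poly c F \<xi>))\<^sup>2 \<partial>unit_interval) \<le> ennreal e"
      using c by (subst sq_norm_eq_integral[symmetric]) (auto simp: le_less_trans[OF c])
    then have "(\<integral>\<xi>. (cmod (h \<xi> - trig_poly c F \<xi>))\<^sup>2 \<partial>unit_interval) \<le> e"
      using e by simp
    then have "?I - ?S F \<le> e"
      using integral_norm_diff_trig_poly[OF h fin F, of c]
        sum_nonneg[of F "\<lambda>k. (cmod (fourier_coeff h k - c k))\<^sup>2"] by simp
    then have "ennreal ?I \<le> ennreal (?S F + e)" by (intro ennreal_leI) simp
    also have "\<dots> = (\<Sum>k\<in>F. ennreal ((cmod (fourier_coeff h k))\<^sup>2)) + ennreal e"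
      using e by (simp add: sum_nonneg)
    also have "\<dots> \<le> sq_norm (count_space UNIV) (fourier_coeff h) + ennreal e"
      unfolding sup using F by (intro add_right_mono SUP_upper) simp
    finally show "sq_norm unit_interval h \<le> sq_norm (count_space UNIV) (fourier_coeff h) + ennreal e"
      unfolding eq .
  qed
qed

section \<open>Periodization\<close>

lemma space_unit_interval [simp]: "space unit_interval = {0..1}"
  by (simp add: space_restrict_space)

lemma emeasure_lborel_vimage_diff:
  fixes a :: real
  assumes [measurable]: "X \<in> sets borel"
  shows "emeasure lborel ((\<lambda>x. x - a) -` X) = emeasure lborel X"
proof -
  have "emeasure lborel X = emeasure (distr lborel borel ((+) (- a))) X"
    by (simp add: lborel_distr_plus)
  also have "\<dots> = emeasure lborel ((+) (- a) -` X)"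
    by (subst emeasure_distr) simp_all
  also have "(+) (- a) -` X = (\<lambda>x. x - a) -` X" by auto
  finally show ?thesis by simp
qed

text \<open>Neighbouring unit intervals overlap only in a point, so closed intervals may be used.\<close>

lemma lborel_eq_distr_unit_interval:
  "lborel = distr (count_space UNIV \<Otimes>\<^sub>M unit_interval) lborel (\<lambda>(j::int, x). x - of_int j)"
    (is "_ = distr ?P _ ?T")
proof (rule measure_eqI)
  have T [measurable]: "?T \<in> measurable ?P lborel"
    unfolding measurable_lborel2 measurable_split_conv
    by (intro measurable_pair_measure_countable1) (auto intro!: measurable_restrict_space1)
  fix A :: "real set" assume Al: "A \<in> sets lborel"
  then have A [measurable]: "A \<in> sets borel" by simp
  \<comment> \<open>The half-open intervals partition the line, so countable additivity applies to
    them; each closed slice differs from one of them by a single null point.\<close>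
  let ?J = "\<lambda>j::int. {- of_int j..<1 - of_int j} :: real set"
  have slice: "emeasure unit_interval (Pair j -` (?T -` A \<inter> space ?P)) = emeasure lborel (A \<inter> ?J j)" for j
  proof -
    have "Pair j -` (?T -` A \<inter> space ?P) = (\<lambda>x. x - of_int j) -` (A \<inter> {- of_int j..1 - of_int j})"
      by (auto simp: space_pair_measure)
    moreover have "\<dots> \<subseteq> {0..1}" by auto
    ultimately have "emeasure unit_interval (Pair j -` (?T -` A \<inter> space ?P)) =
        emeasure lborel ((\<lambda>x. x - of_int j) -` (A \<inter> {- of_int j..1 - of_int j}))"
      by (simp add: emeasure_restrict_space)
    also have "\<dots> = emeasure lborel (A \<inter> {- of_int j..1 - of_int j})"
      by (intro emeasure_lborel_vimage_diff) simp
    also have "\<dots> = emeasure lborel (A \<inter> ?J j)"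
    proof (rule emeasure_eq_AE)
      have "AE x in lborel. x \<noteq> 1 - real_of_int j" by (rule AE_lborel_singleton)
      then show "AE x in lborel. (x \<in> A \<inter> {- of_int j..1 - of_int j}) = (x \<in> A \<inter> ?J j)"
        by eventually_elim auto
    qed auto
    finally show ?thesis .
  qed
  have "emeasure (distr ?P lborel ?T) A = emeasure ?P (?T -` A \<inter> space ?P)"
    by (rule emeasure_distr[OF T Al])
  also have "\<dots> = (\<integral>\<^sup>+ j. emeasure unit_interval (Pair j -` (?T -` A \<inter> space ?P)) \<partial>count_space UNIV)"
    by (intro unit_interval.emeasure_pair_measure_alt measurable_sets[OF T Al])
  also have "\<dots> = (\<integral>\<^sup>+ j. emeasure lborel (A \<inter> ?J j) \<partial>count_space UNIV)"
    by (simp only: slice)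
  also have "\<dots> = emeasure lborel (\<Union>j\<in>UNIV. A \<inter> ?J j)"
  proof (rule emeasure_UN_countable[symmetric])
    have "j = j'" if "x \<in> ?J j" "x \<in> ?J j'" for j j' x
    proof -
      have "\<lfloor>x\<rfloor> = - j" "\<lfloor>x\<rfloor> = - j'" using that by (auto simp: floor_eq_iff)
      then show ?thesis by simp
    qed
    then show "disjoint_family_on (\<lambda>j. A \<inter> ?J j) UNIV"
      by (force simp: disjoint_family_on_def)
  qed auto
  also have "(\<Union>j\<in>UNIV. A \<inter> ?J j) = A"
  proof -
    have "x \<in> ?J (- \<lfloor>x\<rfloor>)" for x by (auto simp: of_int_floor_le) linarith
    then show ?thesis by blast
  qed
  finally show "emeasure lborel A = emeasure (distr ?P lborel ?T) A" by simp
qed simp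

interpretation counting_int: sigma_finite_measure "count_space (UNIV :: int set)"
  by (intro sigma_finite_measure_count_space_countable) simp

interpretation periodization: pair_sigma_finite "count_space (UNIV :: int set)" unit_interval ..

lemma measurable_diff_of_int [measurable]:
  "(\<lambda>(j::int, x). x - of_int j) \<in> measurable (count_space UNIV \<Otimes>\<^sub>M unit_interval) borel"
  unfolding measurable_split_conv
  by (intro measurable_pair_measure_countable1) (auto intro!: measurable_restrict_space1)

lemma nn_integral_periodize:
  fixes f :: "real \<Rightarrow> ennreal"
  assumes [measurable]: "f \<in> borel_measurable borel"
  shows "(\<integral>\<^sup>+ x. f x \<partial>lborel) = (\<integral>\<^sup>+ x. (\<integral>\<^sup>+ j. f (x - of_int j) \<partial>count_space UNIV) \<partial>unit_interval)"
proof -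
  have "(\<integral>\<^sup>+ x. f x \<partial>lborel) = (\<integral>\<^sup>+ z. f (case z of (j::int, x) \<Rightarrow> x - of_int j) \<partial>(count_space UNIV \<Otimes>\<^sub>M unit_interval))"
    by (subst lborel_eq_distr_unit_interval) (intro nn_integral_distr, simp_all)
  also have "\<dots> = (\<integral>\<^sup>+ x. (\<integral>\<^sup>+ j. f (x - of_int j) \<partial>count_space UNIV) \<partial>unit_interval)"
    by (subst periodization.nn_integral_snd[symmetric]) (simp_all add: split_beta')
  finally show ?thesis .
qed

text \<open>Fubini on the product with counting measure. At points where the periodized series
  diverges, the inner integral and \<open>infsum\<close> take the same default value, so the
  integrands agree everywhere and no exceptional set has to be tracked.\<close>

lemma integral_periodize:
  fixes f :: "real \<Rightarrow> complex"
  assumes f: "integrable lborel f"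
  shows "(\<integral> x. f x \<partial>lborel) = (\<integral> x. (\<Sum>\<^sub>\<infinity>j::int. f (x - of_int j)) \<partial>unit_interval)"
proof -
  have [measurable]: "f \<in> borel_measurable borel" using f by auto
  have "integrable (distr (count_space UNIV \<Otimes>\<^sub>M unit_interval) lborel (\<lambda>(j::int, x). x - of_int j)) f"
    using f by (simp add: lborel_eq_distr_unit_interval[symmetric])
  then have int: "integrable (count_space UNIV \<Otimes>\<^sub>M unit_interval) (\<lambda>(j::int, x). f (x - of_int j))"
    by (subst (asm) integrable_distr_eq) (simp_all add: split_beta')
  have "(\<integral> x. f x \<partial>lborel) = (\<integral> z. f (case z of (j::int, x) \<Rightarrow> x - of_int j) \<partial>(count_space UNIV \<Otimes>\<^sub>M unit_interval))"
    by (subst lborel_eq_distr_unit_interval) (intro integral_distr, simp_all)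
  also have "\<dots> = (\<integral> x. (\<integral> j. f (x - of_int j) \<partial>count_space UNIV) \<partial>unit_interval)"
    using periodization.integral_snd[OF int] by (simp add: split_beta')
  finally show ?thesis by (simp add: infsum_eq_integral_count_space)
qed

section \<open>Amalgam bounds and sampling sums\<close>

lemma shift_series_eq_integral:
  "shift_series u c y = (\<integral>k. c k * u (y - of_int k) \<partial>count_space UNIV)"
  by (simp add: shift_series_def infsum_eq_integral_count_space)

text \<open>A bound \<open>W\<close> for the amalgam norm of sup over unit cells and sum over cells,
  witnessed by any dominating sequence \<open>b\<close> instead of the exact suprema. For a
  difference of translates such a \<open>b\<close> can be assembled from different estimates on
  different cells.\<close>

definition amalgam_le :: "(real \<Rightarrow> complex) \<Rightarrow> real \<Rightarrow> bool" where
  "amalgam_le u W \<longleftrightarrow> 0 \<le> W \<and> (\<exists>b. (\<forall>k. 0 \<le> b k) \<and> (\<forall>y. cmod (u y) \<le> b \<lfloor>y\<rfloor>) \<and>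
      (\<integral>\<^sup>+ k. ennreal (b k) \<partial>count_space (UNIV :: int set)) \<le> ennreal W)"

lemma nn_integral_count_space_reflect:
  fixes f :: "int \<Rightarrow> ennreal"
  shows "(\<integral>\<^sup>+ k. f (m - k) \<partial>count_space UNIV) = (\<integral>\<^sup>+ k. f k \<partial>count_space UNIV)"
proof -
  have "bij_betw (\<lambda>k. m - k) UNIV UNIV"
    by (rule bij_betwI[where g="\<lambda>k. m - k"]) auto
  from nn_integral_bij_count_space[OF this, of f] show ?thesis .
qed

text \<open>The points \<open>y - k\<close> meet every integer cell exactly once, so the bound does
  not depend on \<open>y\<close>.\<close>

lemma amalgam_le_sum_shifts:
  assumes "amalgam_le u W"
  shows "(\<integral>\<^sup>+ k. ennreal (cmod (u (y - of_int k))) \<partial>count_space UNIV) \<le> ennreal W"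
proof -
  obtain b where b: "\<And>k. 0 \<le> b k" "\<And>y. cmod (u y) \<le> b \<lfloor>y\<rfloor>"
    and W: "(\<integral>\<^sup>+ k. ennreal (b k) \<partial>count_space (UNIV :: int set)) \<le> ennreal W"
    using assms by (auto simp: amalgam_le_def)
  have "(\<integral>\<^sup>+ k. ennreal (cmod (u (y - of_int k))) \<partial>count_space UNIV)
      \<le> (\<integral>\<^sup>+ k. ennreal (b (\<lfloor>y\<rfloor> - k)) \<partial>count_space UNIV)"
  proof (intro nn_integral_mono ennreal_leI)
    fix k :: int
    show "cmod (u (y - of_int k)) \<le> b (\<lfloor>y\<rfloor> - k)" using b(2)[of "y - of_int k"] by simp
  qed
  also have "\<dots> = (\<integral>\<^sup>+ k. ennreal (b k) \<partial>count_space UNIV)"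
    by (rule nn_integral_count_space_reflect)
  finally show ?thesis using W by simp
qed

lemma cmod_le_sq_norm_count:
  "ennreal ((cmod (c k))\<^sup>2) \<le> sq_norm (count_space UNIV) c"
proof -
  have "(\<integral>\<^sup>+ i. ennreal ((cmod (c i))\<^sup>2) * indicator {k} i \<partial>count_space UNIV) \<le> sq_norm (count_space UNIV) c"
    unfolding sq_norm_def by (intro nn_integral_mono) (simp add: indicator_def)
  moreover have "(\<integral>\<^sup>+ i. ennreal ((cmod (c i))\<^sup>2) * indicator {k} i \<partial>count_space UNIV) = ennreal ((cmod (c k))\<^sup>2)"
    by (subst nn_integral_count_space'[where A="{k}"]) auto
  ultimately show ?thesis by simp
qed

text \<open>A square-summable \<open>c\<close> is bounded, and the integer shifts of
  \<open>u\<close> are absolutely summable at each point. The shift series therefore converges at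
  every \<open>y\<close>, which pointwise sampling requires.\<close>

lemma integrable_shift_terms:
  assumes u: "amalgam_le u W" and c: "sq_norm (count_space UNIV) c < \<infinity>"
  shows "integrable (count_space UNIV) (\<lambda>k. c k * u (y - of_int k))"
proof (rule integrableI_bounded)
  define B where "B = sqrt (enn2real (sq_norm (count_space UNIV) c))"
  have B: "cmod (c k) \<le> B" for k
  proof -
    have "(cmod (c k))\<^sup>2 \<le> enn2real (sq_norm (count_space UNIV) c)"
      using enn2real_mono[OF cmod_le_sq_norm_count[of c k]] c by simp
    then show ?thesis unfolding B_def by (rule real_le_rsqrt)
  qed
  have "(\<integral>\<^sup>+ k. ennreal (norm (c k * u (y - of_int k))) \<partial>count_space UNIV)
      \<le> (\<integral>\<^sup>+ k. ennreal B * ennreal (cmod (u (y - of_int k))) \<partial>count_space UNIV)"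
    using B order_trans[OF norm_ge_zero B]
    by (intro nn_integral_mono) (auto simp: norm_mult ennreal_mult[symmetric] intro!: ennreal_leI mult_right_mono)
  also have "\<dots> = ennreal B * (\<integral>\<^sup>+ k. ennreal (cmod (u (y - of_int k))) \<partial>count_space UNIV)"
    by (rule nn_integral_cmult) simp
  also have "\<dots> \<le> ennreal B * ennreal W"
    by (intro mult_left_mono amalgam_le_sum_shifts[OF u]) simp
  also have "\<dots> < \<infinity>" by (simp add: ennreal_mult_less_top)
  finally show "(\<integral>\<^sup>+ k. ennreal (norm (c k * u (y - of_int k))) \<partial>count_space UNIV) < \<infinity>" .
qed simp

section \<open>Sums over separated sets and Schur's test\<close>

definition separated_by :: "nat \<Rightarrow> real set \<Rightarrow> bool" where
  "separated_by N \<Lambda> \<longleftrightarrow> (\<forall>x. finite (\<Lambda> \<inter> {x..x + 1}) \<and> card (\<Lambda> \<inter> {x..x + 1}) \<le> N)"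

lemma separated_by_countable:
  assumes "separated_by N \<Lambda>"
  shows "countable \<Lambda>"
proof -
  have "\<Lambda> \<subseteq> (\<Union>j::int. \<Lambda> \<inter> {of_int j..of_int j + 1})"
  proof
    fix x assume "x \<in> \<Lambda>"
    moreover have "x \<in> {of_int \<lfloor>x\<rfloor>..of_int \<lfloor>x\<rfloor> + 1}" by (auto simp: of_int_floor_le less_imp_le)
    ultimately show "x \<in> (\<Union>j::int. \<Lambda> \<inter> {of_int j..of_int j + 1})" by blast
  qed
  moreover have "countable (\<Union>j::int. \<Lambda> \<inter> {of_int j..of_int j + 1})"
    using assms by (intro countable_UN) (auto simp: separated_by_def intro: countable_finite)
  ultimately show ?thesis by (rule countable_subset)
qed

text \<open>Tonelli groups the points of \<Lambda> by the integer cell of \<open>l + x\<close>. The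
  points belonging to one cell lie in a closed interval of length one, so there are at most
  \<open>N\<close> of them, whatever \<open>x\<close> is.\<close>

lemma separated_by_sum_floor:
  fixes b :: "int \<Rightarrow> real"
  assumes sep: "separated_by N \<Lambda>"
  shows "(\<integral>\<^sup>+ l. ennreal (b \<lfloor>l + x\<rfloor>) \<partial>count_space \<Lambda>) \<le> of_nat N * (\<integral>\<^sup>+ m. ennreal (b m) \<partial>count_space UNIV)"
proof -
  have "ennreal (b \<lfloor>l + x\<rfloor>) = (\<integral>\<^sup>+ m. ennreal (b m) * indicator {\<lfloor>l + x\<rfloor>} m \<partial>count_space UNIV)" for l
    by (subst nn_integral_count_space'[where A="{\<lfloor>l + x\<rfloor>}"]) auto
  then have "(\<integral>\<^sup>+ l. ennreal (b \<lfloor>l + x\<rfloor>) \<partial>count_space \<Lambda>) =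
      (\<integral>\<^sup>+ l. (\<integral>\<^sup>+ m. ennreal (b m) * indicator {\<lfloor>l + x\<rfloor>} m \<partial>count_space UNIV) \<partial>count_space \<Lambda>)" by simp
  also have "\<dots> = (\<integral>\<^sup>+ m. (\<integral>\<^sup>+ l. ennreal (b m) * indicator {\<lfloor>l + x\<rfloor>} m \<partial>count_space \<Lambda>) \<partial>count_space UNIV)"
    by (intro nn_integral_count_space_nn_integral) simp_all
  also have "\<dots> \<le> (\<integral>\<^sup>+ m. of_nat N * ennreal (b m) \<partial>count_space UNIV)"
  proof (intro nn_integral_mono)
    fix m :: int
    let ?L = "{l \<in> \<Lambda>. \<lfloor>l + x\<rfloor> = m}"
    have "y \<in> {of_int m - x..of_int m - x + 1}" if "\<lfloor>y + x\<rfloor> = m" for y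
      using that by (auto simp: floor_eq_iff)
    then have sub: "?L \<subseteq> \<Lambda> \<inter> {of_int m - x..of_int m - x + 1}" by auto
    have fin: "finite (\<Lambda> \<inter> {of_int m - x..of_int m - x + 1})" "card (\<Lambda> \<inter> {of_int m - x..of_int m - x + 1}) \<le> N"
      using sep by (auto simp: separated_by_def)
    have "(\<integral>\<^sup>+ l. ennreal (b m) * indicator {\<lfloor>l + x\<rfloor>} m \<partial>count_space \<Lambda>)
        = (\<integral>\<^sup>+ l. ennreal (b m) * indicator ?L l \<partial>count_space \<Lambda>)"
      by (intro nn_integral_cong) (auto simp: indicator_def)
    also have "\<dots> = ennreal (b m) * emeasure (count_space \<Lambda>) ?L"
      by (subst nn_integral_cmult_indicator) auto
    also have "emeasure (count_space \<Lambda>) ?L = of_nat (card ?L)"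
      using finite_subset[OF sub fin(1)] by (subst emeasure_count_space_finite) auto
    also have "ennreal (b m) * of_nat (card ?L) \<le> ennreal (b m) * of_nat N"
      using card_mono[OF fin(1) sub] fin(2) by (intro mult_left_mono) auto
    finally show "(\<integral>\<^sup>+ l. ennreal (b m) * indicator {\<lfloor>l + x\<rfloor>} m \<partial>count_space \<Lambda>) \<le> of_nat N * ennreal (b m)"
      by (simp add: mult.commute)
  qed
  also have "\<dots> = of_nat N * (\<integral>\<^sup>+ m. ennreal (b m) \<partial>count_space UNIV)"
    by (rule nn_integral_cmult) simp
  finally show ?thesis .
qed

definition sampling_sum :: "(real \<Rightarrow> complex) \<Rightarrow> real set \<Rightarrow> real \<Rightarrow> (int \<Rightarrow> complex) \<Rightarrow> ennreal" where
  "sampling_sum u \<Lambda> x c = sq_norm (count_space \<Lambda>) (\<lambda>l. shift_series u c (l + x))"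

text \<open>Schur's test.\<close>

lemma sampling_sum_le:
  assumes u: "amalgam_le u W" and sep: "separated_by N \<Lambda>"
  shows "sampling_sum u \<Lambda> x c \<le> ennreal (real N * W\<^sup>2) * sq_norm (count_space UNIV) c"
proof -
  obtain b where b: "\<And>k. 0 \<le> b k" "\<And>y. cmod (u y) \<le> b \<lfloor>y\<rfloor>"
    and W: "(\<integral>\<^sup>+ k. ennreal (b k) \<partial>count_space (UNIV :: int set)) \<le> ennreal W" and W0: "0 \<le> W"
    using u by (auto simp: amalgam_le_def)
  \<comment> \<open>The row estimate: Cauchy-Schwarz after writing the kernel \<open>b\<close> as a
    product of two square roots. One root stays with \<open>c\<close>, the other contributes the
    total mass \<open>W\<close>.\<close>
  have pt: "ennreal ((cmod (shift_series u c y))\<^sup>2) \<le>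
      ennreal W * (\<integral>\<^sup>+ k. ennreal ((cmod (c k))\<^sup>2) * ennreal (b (\<lfloor>y\<rfloor> - k)) \<partial>count_space UNIV)" for y
  proof -
    have "ennreal (cmod (shift_series u c y)) \<le> (\<integral>\<^sup>+ k. ennreal (norm (c k * u (y - of_int k))) \<partial>count_space UNIV)"
    \<comment> \<open>If the terms are not integrable, the series has value 0 by convention and the
      bound is trivial.\<close>
    proof (cases "integrable (count_space UNIV) (\<lambda>k. c k * u (y - of_int k))")
      case True
      then show ?thesis unfolding shift_series_eq_integral by (rule integral_norm_bound_ennreal)
    next
      case False
      then show ?thesis unfolding shift_series_eq_integral by (simp add: not_integrable_integral_eq)
    qed
    also have "\<dots> \<le> (\<integral>\<^sup>+ k. ennreal (cmod (c k) * sqrt (b (\<lfloor>y\<rfloor> - k))) * ennreal (sqrt (b (\<lfloor>y\<rfloor> - k))) \<partial>count_space UNIV)"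
    proof (intro nn_integral_mono)
      fix k :: int
      have "cmod (u (y - of_int k)) \<le> b (\<lfloor>y\<rfloor> - k)" using b(2)[of "y - of_int k"] by simp
      then have "norm (c k * u (y - of_int k)) \<le> cmod (c k) * (sqrt (b (\<lfloor>y\<rfloor> - k)) * sqrt (b (\<lfloor>y\<rfloor> - k)))"
        using b(1) by (simp add: norm_mult mult_left_mono)
      then show "ennreal (norm (c k * u (y - of_int k))) \<le>
          ennreal (cmod (c k) * sqrt (b (\<lfloor>y\<rfloor> - k))) * ennreal (sqrt (b (\<lfloor>y\<rfloor> - k)))"
        using b(1) by (simp add: ennreal_mult[symmetric] mult.assoc ennreal_leI del: real_sqrt_mult_self)
    qed
    finally have "(ennreal (cmod (shift_series u c y)))\<^sup>2 \<le>
        (\<integral>\<^sup>+ k. ennreal (cmod (c k) * sqrt (b (\<lfloor>y\<rfloor> - k))) * ennreal (sqrt (b (\<lfloor>y\<rfloor> - k))) \<partial>count_space UNIV)\<^sup>2"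
      by (intro power_mono) auto
    also have "\<dots> \<le> (\<integral>\<^sup>+ k. (ennreal (cmod (c k) * sqrt (b (\<lfloor>y\<rfloor> - k))))\<^sup>2 \<partial>count_space UNIV) *
        (\<integral>\<^sup>+ k. (ennreal (sqrt (b (\<lfloor>y\<rfloor> - k))))\<^sup>2 \<partial>count_space UNIV)"
      by (rule Cauchy_Schwarz_nn_integral) simp_all
    also have "\<dots> = (\<integral>\<^sup>+ k. ennreal ((cmod (c k))\<^sup>2) * ennreal (b (\<lfloor>y\<rfloor> - k)) \<partial>count_space UNIV) *
        (\<integral>\<^sup>+ k. ennreal (b (\<lfloor>y\<rfloor> - k)) \<partial>count_space UNIV)"
      using b(1) by (simp add: ennreal_power power_mult_distrib ennreal_mult)
    also have "\<dots> \<le> (\<integral>\<^sup>+ k. ennreal ((cmod (c k))\<^sup>2) * ennreal (b (\<lfloor>y\<rfloor> - k)) \<partial>count_space UNIV) * ennreal W"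
      using W by (intro mult_left_mono) (simp_all add: nn_integral_count_space_reflect[of "\<lambda>k. ennreal (b k)"])
    finally show ?thesis by (simp add: ennreal_power mult.commute)
  qed
  have "sampling_sum u \<Lambda> x c \<le> (\<integral>\<^sup>+ l. ennreal W *
      (\<integral>\<^sup>+ k. ennreal ((cmod (c k))\<^sup>2) * ennreal (b (\<lfloor>l + x\<rfloor> - k)) \<partial>count_space UNIV) \<partial>count_space \<Lambda>)"
    unfolding sampling_sum_def sq_norm_def by (intro nn_integral_mono pt)
  also have "\<dots> = ennreal W * (\<integral>\<^sup>+ l. (\<integral>\<^sup>+ k. ennreal ((cmod (c k))\<^sup>2) * ennreal (b (\<lfloor>l + x\<rfloor> - k)) \<partial>count_space UNIV) \<partial>count_space \<Lambda>)"
    by (rule nn_integral_cmult) simp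
  \<comment> \<open>The column estimate: after exchanging the sums, the sum over \<Lambda> for fixed
    k is at most \<open>N * W\<close>. Together with the row factor \<open>W\<close> this gives the
    Schur constant.\<close>
  also have "(\<integral>\<^sup>+ l. (\<integral>\<^sup>+ k. ennreal ((cmod (c k))\<^sup>2) * ennreal (b (\<lfloor>l + x\<rfloor> - k)) \<partial>count_space UNIV) \<partial>count_space \<Lambda>)
      = (\<integral>\<^sup>+ k. (\<integral>\<^sup>+ l. ennreal ((cmod (c k))\<^sup>2) * ennreal (b (\<lfloor>l + x\<rfloor> - k)) \<partial>count_space \<Lambda>) \<partial>count_space UNIV)"
    by (intro nn_integral_count_space_nn_integral) simp_all
  also have "\<dots> \<le> (\<integral>\<^sup>+ k. ennreal ((cmod (c k))\<^sup>2) * (of_nat N * ennreal W) \<partial>count_space UNIV)"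
  proof (intro nn_integral_mono)
    fix k :: int
    have "(\<integral>\<^sup>+ l. ennreal (b (\<lfloor>l + x\<rfloor> - k)) \<partial>count_space \<Lambda>) \<le> of_nat N * (\<integral>\<^sup>+ m. ennreal (b (m - k)) \<partial>count_space UNIV)"
      by (rule separated_by_sum_floor[OF sep, of "\<lambda>m. b (m - k)"])
    also have "(\<integral>\<^sup>+ m. ennreal (b (m - k)) \<partial>count_space UNIV) = (\<integral>\<^sup>+ m. ennreal (b m) \<partial>count_space UNIV)"
      using nn_integral_count_space_reflect[of "\<lambda>m. ennreal (b (m - k))" 0]
        nn_integral_count_space_reflect[of "\<lambda>m. ennreal (b m)" "- k"]
      by (simp add: minus_diff_commute)
    also have "of_nat N * \<dots> \<le> of_nat N * ennreal W" using W by (intro mult_left_mono) auto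
    finally have "ennreal ((cmod (c k))\<^sup>2) * (\<integral>\<^sup>+ l. ennreal (b (\<lfloor>l + x\<rfloor> - k)) \<partial>count_space \<Lambda>)
        \<le> ennreal ((cmod (c k))\<^sup>2) * (of_nat N * ennreal W)" by (intro mult_left_mono) auto
    then show "(\<integral>\<^sup>+ l. ennreal ((cmod (c k))\<^sup>2) * ennreal (b (\<lfloor>l + x\<rfloor> - k)) \<partial>count_space \<Lambda>)
        \<le> ennreal ((cmod (c k))\<^sup>2) * (of_nat N * ennreal W)" by (simp add: nn_integral_cmult)
  qed
  also have "\<dots> = sq_norm (count_space UNIV) c * (of_nat N * ennreal W)"
    unfolding sq_norm_def by (rule nn_integral_multc) simp
  finally have "sampling_sum u \<Lambda> x c \<le> ennreal W * (sq_norm (count_space UNIV) c * (of_nat N * ennreal W))"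
    by (simp add: mult_left_mono)
  also have "\<dots> = ennreal (real N * W\<^sup>2) * sq_norm (count_space UNIV) c"
    using W0 by (simp add: ennreal_mult power2_eq_square ennreal_of_nat_eq_real_of_nat mult_ac)
  finally show ?thesis .
qed

lemma shift_series_perturb:
  assumes g: "amalgam_le g W" and h: "amalgam_le (\<lambda>y. g (y + t) - g y) V"
    and c: "sq_norm (count_space UNIV) c < \<infinity>"
  shows "shift_series g c (y + t) = shift_series g c y + shift_series (\<lambda>y. g (y + t) - g y) c y"
  unfolding shift_series_eq_integral
  by (subst Bochner_Integration.integral_add[symmetric])
    (use integrable_shift_terms[OF g c] integrable_shift_terms[OF h c] in \<open>auto simp: algebra_simps\<close>)

lemma shift_series_add:
  assumes g: "amalgam_le g W" and c: "sq_norm (count_space UNIV) c < \<infinity>" "sq_norm (count_space UNIV) d < \<infinity>"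
  shows "shift_series g (\<lambda>k. c k + d k) y = shift_series g c y + shift_series g d y"
  unfolding shift_series_eq_integral
  by (subst Bochner_Integration.integral_add[symmetric])
    (use integrable_shift_terms[OF g c(1)] integrable_shift_terms[OF g c(2)] in \<open>auto simp: algebra_simps\<close>)

text \<open>Functions, sequences and translations may all differ between the three terms, so that
  the same estimate serves a perturbed translation and a split sequence.\<close>

lemma sampling_sum_add_le:
  assumes "\<And>l. l \<in> \<Lambda> \<Longrightarrow> shift_series u c (l + x) = shift_series v d (l + y) + shift_series w e (l + z)"
    and "0 < t"
  shows "sampling_sum u \<Lambda> x c \<le> ennreal (1 + t) * sampling_sum v \<Lambda> y d + ennreal (1 + 1 / t) * sampling_sum w \<Lambda> z e"
proof -
  have "sampling_sum u \<Lambda> x c = sq_norm (count_space \<Lambda>) (\<lambda>l. shift_series v d (l + y) + shift_series w e (l + z))"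
    unfolding sampling_sum_def sq_norm_def by (intro nn_integral_cong) (simp add: assms(1))
  also have "\<dots> \<le> ennreal (1 + t) * sampling_sum v \<Lambda> y d + ennreal (1 + 1 / t) * sampling_sum w \<Lambda> z e"
    unfolding sampling_sum_def by (intro sq_norm_add_le assms) simp_all
  finally show ?thesis .
qed

section \<open>Wiener functions: amalgam bounds and continuity of translation\<close>

lemma wiener_space_bound:
  assumes "g \<in> wiener_space"
  obtains a where "\<And>k::int. 0 \<le> a k" "\<And>y. cmod (g y) \<le> a \<lfloor>y\<rfloor>" "a summable_on UNIV"
proof -
  define a where "a k = (SUP x\<in>{of_int k..of_int k + 1}. cmod (g x))" for k :: int
  have le: "cmod (g y) \<le> a k" if "y \<in> {of_int k..of_int k + 1}" for k y
  proof -
    have "continuous_on {of_int k..of_int k + 1} (\<lambda>x. cmod (g x))"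
      using assms by (auto simp: wiener_space_def intro!: continuous_intros intro: continuous_on_subset)
    then have "compact ((\<lambda>x. cmod (g x)) ` {of_int k..of_int k + 1})"
      by (intro compact_continuous_image) auto
    then have "bdd_above ((\<lambda>x. cmod (g x)) ` {of_int k..of_int k + 1})"
      by (intro bounded_imp_bdd_above compact_imp_bounded)
    then show ?thesis unfolding a_def using that by (intro cSUP_upper)
  qed
  have "y \<in> {of_int \<lfloor>y\<rfloor>..of_int \<lfloor>y\<rfloor> + 1}" for y :: real
    by (auto simp: of_int_floor_le less_imp_le)
  then have "cmod (g y) \<le> a \<lfloor>y\<rfloor>" for y by (rule le)
  moreover have "0 \<le> a k" for k
    using order_trans[OF norm_ge_zero le[of "of_int k" k]] by simp
  moreover have "a summable_on UNIV" using assms by (simp add: wiener_space_def a_def[abs_def])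
  ultimately show ?thesis using that by blast
qed

lemma nn_integral_count_space_summable:
  fixes a :: "'a \<Rightarrow> real"
  assumes "\<And>k. 0 \<le> a k" "a summable_on UNIV" "countable (UNIV :: 'a set)"
  shows "(\<integral>\<^sup>+ k. ennreal (a k) \<partial>count_space UNIV) = ennreal (infsum a UNIV)"
proof -
  have "ennreal (infsum a UNIV) = (SUP F\<in>{F. finite F \<and> F \<subseteq> UNIV}. ennreal (sum a F))"
    using assms by (intro infsum_nonneg_is_SUPREMUM_ennreal) auto
  also have "\<dots> = (SUP F\<in>{F. finite F \<and> F \<subseteq> UNIV}. (\<Sum>k\<in>F. ennreal (a k)))"
    using assms(1) by simp
  also have "\<dots> = (\<Sum>\<^sub>\<infinity>k. ennreal (a k))"
    by (rule nonneg_infsum_complete[symmetric]) simp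
  also have "\<dots> = (\<integral>\<^sup>+ k. ennreal (a k) \<partial>count_space UNIV)"
    by (rule countable_infsum_ennreal_eq_nn_integral[OF assms(3)])
  finally show ?thesis by simp
qed

lemma wiener_space_amalgam:
  assumes "g \<in> wiener_space"
  obtains W where "amalgam_le g W"
proof -
  obtain a where a: "\<And>k::int. 0 \<le> a k" "\<And>y. cmod (g y) \<le> a \<lfloor>y\<rfloor>" "a summable_on UNIV"
    using wiener_space_bound[OF assms] by blast
  have "amalgam_le g (infsum a UNIV)"
    unfolding amalgam_le_def using a nn_integral_count_space_summable[OF a(1,3)]
    by (auto intro!: infsum_nonneg exI[of _ a])
  then show ?thesis by (rule that)
qed

lemma summable_finite_tail:
  fixes d :: "'a \<Rightarrow> real"
  assumes "d summable_on UNIV" "0 < \<epsilon>"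
  obtains K where "finite K" "infsum d (- K) \<le> \<epsilon>"
proof -
  have "(sum d \<longlongrightarrow> infsum d UNIV) (finite_subsets_at_top UNIV)"
    using has_sum_infsum[OF assms(1)] by (simp add: has_sum_def)
  then have "eventually (\<lambda>K. infsum d UNIV - \<epsilon> < sum d K) (finite_subsets_at_top UNIV)"
    using assms(2) by (intro order_tendstoD) auto
  then have "eventually (\<lambda>K. infsum d UNIV - \<epsilon> < sum d K \<and> finite K) (finite_subsets_at_top UNIV)"
    by (intro eventually_conj) auto
  then obtain K where K: "infsum d UNIV - \<epsilon> < sum d K" "finite K"
    using eventually_happens'[OF finite_subsets_at_top_neq_bot] by blast
  have "infsum d (- K) = infsum d UNIV - infsum d K"
    using infsum_Diff[OF assms(1), of K] K(2) by (simp add: Compl_eq_Diff_UNIV)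
  then show ?thesis using K that[of K] by simp
qed

text \<open>All but finitely many cells together contribute at most \<open>\<epsilon> / 2\<close>,
  uniformly for shifts shorter than 1; on the remaining cells uniform continuity on a compact
  interval makes the difference small.\<close>

lemma wiener_space_translation_continuous:
  assumes g: "g \<in> wiener_space" and \<epsilon>: "0 < \<epsilon>"
  obtains \<delta> where "0 < \<delta>" "\<And>t. \<bar>t\<bar> < \<delta> \<Longrightarrow> amalgam_le (\<lambda>y. g (y + t) - g y) \<epsilon>"
proof -
  obtain a where a: "\<And>k::int. 0 \<le> a k" "\<And>y. cmod (g y) \<le> a \<lfloor>y\<rfloor>" "a summable_on UNIV"
    using wiener_space_bound[OF g] by blast
  \<comment> \<open>A shift shorter than 1 moves \<open>y\<close> at most into a neighbouring cell.
    The coefficient 2 covers the case that \<open>y\<close> and \<open>y + t\<close> share a cell,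
    where \<open>a\<close> is counted for both.\<close>
  define d where "d k = a (k - 1) + 2 * a k + a (k + 1)" for k
  have shift: "(\<lambda>k. a (k + j)) summable_on UNIV" for j
  proof -
    have "bij_betw (\<lambda>k. k + j) UNIV UNIV" by (rule bij_betwI[where g="\<lambda>k. k - j"]) auto
    from summable_on_reindex_bij_betw[OF this, of a] a(3) show ?thesis by simp
  qed
  have d: "d summable_on UNIV"
    unfolding d_def using shift[of "-1"] shift[of 1] a(3)
    by (intro summable_on_add summable_on_cmult_right) auto
  have d0: "0 \<le> d k" for k using a(1) by (simp add: d_def)
  obtain K where K: "finite K" and tail: "infsum d (- K) \<le> \<epsilon> / 2"
    using summable_finite_tail[OF d, of "\<epsilon> / 2"] \<epsilon> by auto
  \<comment> \<open>The margin 2 accounts for the length of a cell and for a shift by less than 1,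
    so \<open>y\<close> and \<open>y + t\<close> stay in the compact interval.\<close>
  define R where "R = real_of_int (Max (insert 0 (abs ` K))) + 2"
  have R: "\<bar>of_int k\<bar> + 2 \<le> R" if "k \<in> K" for k
  proof -
    have "\<bar>k\<bar> \<le> Max (insert 0 (abs ` K))" using that K by (intro Max_ge) auto
    then have "real_of_int \<bar>k\<bar> \<le> real_of_int (Max (insert 0 (abs ` K)))" by (simp only: of_int_le_iff)
    then show ?thesis by (simp add: R_def)
  qed
  have "uniformly_continuous_on {- R..R} g"
    using g by (intro compact_uniformly_continuous) (auto simp: wiener_space_def intro: continuous_on_subset)
  \<comment> \<open>Half of \<epsilon> is distributed over the cells in \<open>K\<close>; adding 1
    keeps the denominator positive when \<open>K\<close> is empty.\<close>
  moreover define \<eta> where "\<eta> = \<epsilon> / 2 / (real (card K) + 1)"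
  have \<eta>: "0 < \<eta>" using \<epsilon> by (simp add: \<eta>_def)
  ultimately obtain \<delta> where \<delta>: "0 < \<delta>"
    and uc: "\<And>x y. x \<in> {- R..R} \<Longrightarrow> y \<in> {- R..R} \<Longrightarrow> dist y x < \<delta> \<Longrightarrow> dist (g y) (g x) < \<eta>"
    unfolding uniformly_continuous_on_def by metis
  show ?thesis
  proof (rule that)
    show "0 < min \<delta> 1" using \<delta> by simp
    fix t :: real assume t: "\<bar>t\<bar> < min \<delta> 1"
    define b where "b k = (if k \<in> K then \<eta> else d k)" for k
    have "cmod (g (y + t) - g y) \<le> b \<lfloor>y\<rfloor>" for y
    proof (cases "\<lfloor>y\<rfloor> \<in> K")
      case True
      have "of_int \<lfloor>y\<rfloor> \<le> y" "y < of_int \<lfloor>y\<rfloor> + 1" by (auto simp: of_int_floor_le)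
      then have "- R \<le> y" "y \<le> R" "- R \<le> y + t" "y + t \<le> R" using R[OF True] t by linarith+
      then have "y \<in> {- R..R}" "y + t \<in> {- R..R}" by auto
      then have "dist (g (y + t)) (g y) < \<eta>" using t by (intro uc) (auto simp: dist_real_def)
      then show ?thesis using True by (simp add: b_def dist_norm)
    next
      case False
      have "\<lfloor>y + t\<rfloor> = \<lfloor>y\<rfloor> - 1 \<or> \<lfloor>y + t\<rfloor> = \<lfloor>y\<rfloor> \<or> \<lfloor>y + t\<rfloor> = \<lfloor>y\<rfloor> + 1"
        using t by linarith
      then have "a \<lfloor>y + t\<rfloor> + a \<lfloor>y\<rfloor> \<le> d \<lfloor>y\<rfloor>"
        using a(1)[of "\<lfloor>y\<rfloor> - 1"] a(1)[of "\<lfloor>y\<rfloor>"] a(1)[of "\<lfloor>y\<rfloor> + 1"] by (auto simp: d_def)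
      moreover have "cmod (g (y + t) - g y) \<le> cmod (g (y + t)) + cmod (g y)" by (rule norm_triangle_ineq4)
      ultimately show ?thesis using a(2)[of y] a(2)[of "y + t"] False by (simp add: b_def)
    qed
    moreover have "(\<integral>\<^sup>+ k. ennreal (b k) \<partial>count_space UNIV) \<le> ennreal \<epsilon>"
    proof -
      have dK: "d summable_on - K" using d by (rule summable_on_subset_banach) auto
      have bK: "infsum b K = \<eta> * card K" "b summable_on K"
        using K by (auto simp: b_def)
      have bC: "infsum b (- K) = infsum d (- K)" "b summable_on - K"
        using dK summable_on_cong[of "- K" b d] infsum_cong[of "- K" b d] by (auto simp: b_def)
      have "infsum b UNIV = infsum b K + infsum b (- K)"
        using infsum_Un_disjoint[OF bK(2) bC(2)] by simp
      also have "\<eta> * card K \<le> \<epsilon> / 2"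
        using \<epsilon> by (simp add: \<eta>_def field_simps)
      then have "infsum b K + infsum b (- K) \<le> \<epsilon>" using tail bK bC by simp
      finally have "infsum b UNIV \<le> \<epsilon>" .
      moreover have "b summable_on UNIV" using summable_on_Un_disjoint[OF bK(2) bC(2)] by simp
      ultimately show ?thesis
        using d0 \<eta> by (subst nn_integral_count_space_summable) (auto simp: b_def intro!: ennreal_leI)
    qed
    ultimately show "amalgam_le (\<lambda>y. g (y + t) - g y) \<epsilon>"
      unfolding amalgam_le_def using \<epsilon> d0 \<eta> by (auto intro!: exI[of _ b] simp: b_def)
  qed
qed

text \<open>The error of moving the translation is itself a sampling sum, namely of a difference of
  translates of \<open>g\<close>, and Schur's test bounds it by the square of a small amalgam bound.
  Hence \<delta> is independent of \<open>x\<close>, \<open>y\<close> and \<open>c\<close>.\<close>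

lemma sampling_sum_continuous:
  assumes g: "g \<in> wiener_space" and sep: "separated_by N \<Lambda>" and \<eta>: "0 < \<eta>"
  obtains \<delta> where "0 < \<delta>" "\<And>x y c. \<bar>x - y\<bar> < \<delta> \<Longrightarrow> sq_norm (count_space UNIV) c < \<infinity> \<Longrightarrow>
    sampling_sum g \<Lambda> x c \<le> ennreal (1 + \<eta>) * sampling_sum g \<Lambda> y c + ennreal \<eta> * sq_norm (count_space UNIV) c"
proof -
  obtain W where W: "amalgam_le g W" using wiener_space_amalgam[OF g] by blast
  \<comment> \<open>Solves \<open>(1 + 1 / \<eta>) * (real N + 1) * \<kappa> = \<eta>\<close>. Its
    square root is the amalgam bound requested below, since Schur's test squares it;
    \<open>N + 1\<close> avoids division by zero.\<close>
  define \<kappa> where "\<kappa> = \<eta> / ((1 + 1 / \<eta>) * (real N + 1))"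
  have \<kappa>: "0 < \<kappa>" using \<eta> by (simp add: \<kappa>_def add_pos_pos)
  obtain \<delta> where \<delta>: "0 < \<delta>" and small: "\<And>t. \<bar>t\<bar> < \<delta> \<Longrightarrow> amalgam_le (\<lambda>y. g (y + t) - g y) (sqrt \<kappa>)"
    using wiener_space_translation_continuous[OF g, of "sqrt \<kappa>"] \<kappa> by auto
  show ?thesis
  proof (rule that[OF \<delta>])
    fix x y :: real and c :: "int \<Rightarrow> complex" assume xy: "\<bar>x - y\<bar> < \<delta>" and c: "sq_norm (count_space UNIV) c < \<infinity>"
    let ?h = "\<lambda>z. g (z + (x - y)) - g z"
    note h = small[OF xy]
    have "shift_series g c (l + x) = shift_series g c (l + y) + shift_series ?h c (l + y)" for l
    proof -
      have "l + y + (x - y) = l + x" by simp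
      then show ?thesis using shift_series_perturb[OF W h c, of "l + y"] by (simp only:)
    qed
    then have "sampling_sum g \<Lambda> x c \<le> ennreal (1 + \<eta>) * sampling_sum g \<Lambda> y c + ennreal (1 + 1 / \<eta>) * sampling_sum ?h \<Lambda> y c"
      using \<eta> by (intro sampling_sum_add_le)
    also have "\<dots> \<le> ennreal (1 + \<eta>) * sampling_sum g \<Lambda> y c
        + ennreal (1 + 1 / \<eta>) * (ennreal (real N * (sqrt \<kappa>)\<^sup>2) * sq_norm (count_space UNIV) c)"
      by (intro add_left_mono mult_left_mono sampling_sum_le[OF h sep]) simp
    also have "ennreal (1 + 1 / \<eta>) * (ennreal (real N * (sqrt \<kappa>)\<^sup>2) * sq_norm (count_space UNIV) c)
        = ennreal ((1 + 1 / \<eta>) * (real N * \<kappa>)) * sq_norm (count_space UNIV) c"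
      using \<kappa> \<eta> by (simp add: ennreal_mult mult.assoc)
    also have "\<dots> \<le> ennreal \<eta> * sq_norm (count_space UNIV) c"
    proof (intro mult_right_mono ennreal_leI)
      have "(1 + 1 / \<eta>) * (real N * \<kappa>) \<le> (1 + 1 / \<eta>) * ((real N + 1) * \<kappa>)"
        using \<eta> \<kappa> by (intro mult_left_mono mult_right_mono) auto
      also have "\<dots> = ((1 + 1 / \<eta>) * (real N + 1)) * \<kappa>" by (simp only: mult.assoc)
      also have "\<dots> = \<eta>"
      proof -
        have "(1 + 1 / \<eta>) * (real N + 1) > 0" using \<eta> by (intro mult_pos_pos) (auto simp: add_pos_pos)
        then have "(1 + 1 / \<eta>) * (real N + 1) \<noteq> 0" by (rule less_imp_neq[symmetric])
        then show ?thesis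
          unfolding \<kappa>_def by (subst times_divide_eq_right) (rule nonzero_mult_div_cancel_left)
      qed
      finally show "(1 + 1 / \<eta>) * (real N * \<kappa>) \<le> \<eta>" .
    qed simp
    finally show "sampling_sum g \<Lambda> x c \<le> ennreal (1 + \<eta>) * sampling_sum g \<Lambda> y c + ennreal \<eta> * sq_norm (count_space UNIV) c"
      by (simp add: add_left_mono)
  qed
qed

section \<open>Fibres of Gabor and Zak sums\<close>

lemma borel_measurable_cnj [measurable (raw)]:
  "f \<in> borel_measurable M \<Longrightarrow> (\<lambda>x. cnj (f x)) \<in> borel_measurable M"
  by (rule measurable_compose[OF _ borel_measurable_continuous_onI]) (auto intro!: continuous_intros)

lemma borel_measurable_nn_integral_count_space:
  assumes "countable I" and [measurable]: "\<And>i. i \<in> I \<Longrightarrow> f i \<in> borel_measurable M"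
  shows "(\<lambda>x. \<integral>\<^sup>+ i. f i x \<partial>count_space I) \<in> borel_measurable M"
proof -
  interpret I: sigma_finite_measure "count_space I"
    using assms(1) by (rule sigma_finite_measure_count_space_countable)
  have "(\<lambda>p. f (fst p) (snd p)) \<in> borel_measurable (count_space I \<Otimes>\<^sub>M M)"
    using assms by (intro measurable_pair_measure_countable1) auto
  then have "(\<lambda>(x, i). f i x) \<in> borel_measurable (M \<Otimes>\<^sub>M count_space I)"
    by (subst measurable_pair_swap_iff) (simp add: split_beta')
  then show ?thesis by (rule I.borel_measurable_nn_integral)
qed

lemma borel_measurable_integral_count_space:
  fixes f :: "'i \<Rightarrow> 'a \<Rightarrow> complex"
  assumes "countable I" and [measurable]: "\<And>i. i \<in> I \<Longrightarrow> f i \<in> borel_measurable M"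
  shows "(\<lambda>x. \<integral> i. f i x \<partial>count_space I) \<in> borel_measurable M"
proof -
  interpret I: sigma_finite_measure "count_space I"
    using assms(1) by (rule sigma_finite_measure_count_space_countable)
  have "(\<lambda>p. f (fst p) (snd p)) \<in> borel_measurable (count_space I \<Otimes>\<^sub>M M)"
    using assms by (intro measurable_pair_measure_countable1) auto
  then have "(\<lambda>(x, i). f i x) \<in> borel_measurable (M \<Otimes>\<^sub>M count_space I)"
    by (subst measurable_pair_swap_iff) (simp add: split_beta')
  then show ?thesis by (rule I.borel_measurable_lebesgue_integral)
qed

lemma measurable_unit_interval_diff:
  fixes a :: real
  assumes [measurable]: "f \<in> borel_measurable borel"
  shows "(\<lambda>x. f (x - a)) \<in> borel_measurable unit_interval"
  by (intro measurable_restrict_space1) simp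

lemma measurable_shift_series:
  fixes c :: "int \<Rightarrow> real \<Rightarrow> complex"
  assumes "\<And>j. c j \<in> borel_measurable unit_interval" "continuous_on UNIV g"
  shows "(\<lambda>x. shift_series g (\<lambda>j. c j x) (l + x)) \<in> borel_measurable unit_interval"
  unfolding shift_series_eq_integral
proof (rule borel_measurable_integral_count_space)
  fix j :: int
  note [measurable] = assms(1)
  have [measurable]: "(\<lambda>x. g (l + x - of_int j)) \<in> borel_measurable unit_interval"
    by (intro measurable_unit_interval continuous_intros continuous_on_compose2[OF assms(2)]) auto
  show "(\<lambda>x. c j x * g (l + x - of_int j)) \<in> borel_measurable unit_interval"
    by measurable
qed simp

text \<open>The conjugate is needed because the inner product conjugates \<open>g\<close>, whereas
  \<open>shift_series\<close> uses \<open>g\<close> itself: the periodized product is then the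
  conjugate of a shift series with these coefficients.\<close>

definition fibre :: "(real \<Rightarrow> complex) \<Rightarrow> real \<Rightarrow> int \<Rightarrow> complex" where
  "fibre f x j = cnj (f (x - of_int j))"

lemma measurable_fibre:
  assumes "f \<in> borel_measurable borel"
  shows "(\<lambda>x. fibre f x j) \<in> borel_measurable unit_interval"
proof -
  have [measurable]: "(\<lambda>x. f (x - of_int j)) \<in> borel_measurable unit_interval"
    by (rule measurable_unit_interval_diff[OF assms])
  show ?thesis unfolding fibre_def by measurable
qed

lemma measurable_sq_norm_fibre [measurable]:
  assumes "f \<in> borel_measurable borel"
  shows "(\<lambda>x. sq_norm (count_space UNIV) (fibre f x)) \<in> borel_measurable unit_interval"
  unfolding sq_norm_def
  using measurable_fibre[OF assms] by (intro borel_measurable_nn_integral_count_space) simp_all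

lemma sq_norm_fibre:
  assumes [measurable]: "f \<in> borel_measurable borel"
  shows "sq_norm lborel f = (\<integral>\<^sup>+ x. sq_norm (count_space UNIV) (fibre f x) \<partial>unit_interval)"
  unfolding sq_norm_def by (subst nn_integral_periodize) (simp_all add: fibre_def)

lemma AE_sq_norm_fibre_finite:
  assumes [measurable]: "f \<in> borel_measurable borel" and "sq_norm lborel f < \<infinity>"
  shows "AE x in unit_interval. sq_norm (count_space UNIV) (fibre f x) < \<infinity>"
proof -
  have "AE x in unit_interval. sq_norm (count_space UNIV) (fibre f x) \<noteq> \<infinity>"
    using assms by (intro nn_integral_noteq_infinite) (auto simp: sq_norm_fibre[symmetric])
  then show ?thesis by (simp add: less_top)
qed

lemma amalgam_le_cmod:
  assumes "amalgam_le u W"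
  shows "cmod (u y) \<le> W"
proof -
  have "ennreal (cmod (u (y - of_int 0))) \<le> (\<integral>\<^sup>+ k. ennreal (cmod (u (y - of_int k))) \<partial>count_space UNIV)"
    by (rule nn_integral_ge_point[of "0::int" UNIV "\<lambda>k. ennreal (cmod (u (y - of_int k)))"]) simp
  also have "\<dots> \<le> ennreal W" by (rule amalgam_le_sum_shifts[OF assms])
  finally show ?thesis using assms by (simp add: amalgam_le_def)
qed

text \<open>An amalgam function is bounded by \<open>W\<close> and its periodized modulus is bounded
  by \<open>W\<close>, so its squared norm is at most the square of \<open>W\<close>.\<close>

lemma amalgam_le_sq_norm_lborel:
  assumes u: "amalgam_le u W" and [measurable]: "u \<in> borel_measurable borel"
  shows "sq_norm lborel (\<lambda>y. u (y + l)) < \<infinity>"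
proof -
  have W: "0 \<le> W" using u by (simp add: amalgam_le_def)
  have "sq_norm lborel (\<lambda>y. u (y + l)) = (\<integral>\<^sup>+ x. (\<integral>\<^sup>+ j. ennreal ((cmod (u (x - of_int j + l)))\<^sup>2) \<partial>count_space UNIV) \<partial>unit_interval)"
    unfolding sq_norm_def by (subst nn_integral_periodize) simp_all
  also have "\<dots> \<le> (\<integral>\<^sup>+ x. ennreal W * ennreal W \<partial>unit_interval)"
  proof (intro nn_integral_mono)
    fix x :: real
    have "(\<integral>\<^sup>+ j. ennreal ((cmod (u (x - of_int j + l)))\<^sup>2) \<partial>count_space UNIV)
        \<le> (\<integral>\<^sup>+ j. ennreal W * ennreal (cmod (u (x + l - of_int j))) \<partial>count_space UNIV)"
    proof (intro nn_integral_mono)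
      fix j :: int
      have "x - of_int j + l = x + l - of_int j" by simp
      then show "ennreal ((cmod (u (x - of_int j + l)))\<^sup>2) \<le> ennreal W * ennreal (cmod (u (x + l - of_int j)))"
        using amalgam_le_cmod[OF u, of "x + l - of_int j"] W
        by (simp only:) (simp add: ennreal_mult[symmetric] power2_eq_square mult_right_mono ennreal_leI)
    qed
    also have "\<dots> = ennreal W * (\<integral>\<^sup>+ j. ennreal (cmod (u (x + l - of_int j))) \<partial>count_space UNIV)"
      by (rule nn_integral_cmult) simp
    also have "\<dots> \<le> ennreal W * ennreal W" by (intro mult_left_mono amalgam_le_sum_shifts[OF u]) simp
    finally show "(\<integral>\<^sup>+ j. ennreal ((cmod (u (x - of_int j + l)))\<^sup>2) \<partial>count_space UNIV) \<le> ennreal W * ennreal W" .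
  qed
  also have "\<dots> < \<infinity>" by (simp add: emeasure_restrict_space ennreal_mult_less_top)
  finally show ?thesis .
qed

lemma integrable_mult_sq_norm:
  assumes [measurable]: "f \<in> borel_measurable M" "h \<in> borel_measurable M"
    and fin: "sq_norm M f < \<infinity>" "sq_norm M h < \<infinity>"
  shows "integrable M (\<lambda>x. f x * h x)"
proof (rule integrableI_bounded)
  have "cmod (a * b) \<le> (cmod a)\<^sup>2 + (cmod b)\<^sup>2" for a b
  proof -
    have "0 \<le> (cmod a - cmod b)\<^sup>2" "0 \<le> cmod a * cmod b" by simp_all
    then show ?thesis unfolding norm_mult power2_diff by linarith
  qed
  then have "(\<integral>\<^sup>+ x. ennreal (norm (f x * h x)) \<partial>M) \<le> (\<integral>\<^sup>+ x. ennreal ((cmod (f x))\<^sup>2) + ennreal ((cmod (h x))\<^sup>2) \<partial>M)"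
    by (intro nn_integral_mono) (simp add: ennreal_plus[symmetric] ennreal_leI del: ennreal_plus)
  also have "\<dots> = sq_norm M f + sq_norm M h" unfolding sq_norm_def by (simp add: nn_integral_add)
  also have "\<dots> < \<infinity>" using fin by simp
  finally show "(\<integral>\<^sup>+ x. ennreal (norm (f x * h x)) \<partial>M) < \<infinity>" .
qed simp

text \<open>Integer modulations have period 1; this lets the exponential leave the periodization
  sum.\<close>

lemma cis_integer_shift: "cis (2 * pi * (x - of_int j) * of_int k) = cis (2 * pi * of_int k * x)"
proof -
  have "cis (2 * pi * (x - of_int j) * of_int k) = cis (2 * pi * of_int k * x) * cis (2 * pi * of_int (- (j * k)))"
    by (simp add: cis_mult algebra_simps)
  then show ?thesis by (subst (asm) cis_multiple_2pi) auto
qed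

text \<open>Periodizing the integral over the line moves everything to the unit interval. For fixed
  \<open>l\<close> the inner products over all k become the Fourier coefficients of one function,
  which is what Parseval can sum.\<close>

lemma L2_inner_eq_fourier_coeff:
  assumes g: "amalgam_le g W" "continuous_on UNIV g"
    and f [measurable]: "f \<in> borel_measurable borel" and fin: "sq_norm lborel f < \<infinity>"
  shows "L2_inner f (modulation (of_int k) (translation (- l) g)) =
    fourier_coeff (\<lambda>x. cnj (shift_series g (fibre f x) (l + x))) k"
proof -
  have [measurable]: "g \<in> borel_measurable borel" using g(2) by (rule borel_measurable_continuous_onI)
  let ?e = "\<lambda>x. cis (2 * pi * x * of_int k)"
  have e [measurable]: "?e \<in> borel_measurable borel"
    by (intro borel_measurable_continuous_onI continuous_intros)
  have "sq_norm lborel (\<lambda>y. cnj (?e y * g (y + l))) = sq_norm lborel (\<lambda>y. g (y + l))"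
    by (simp add: sq_norm_def norm_mult)
  then have int: "integrable lborel (\<lambda>y. f y * cnj (?e y * g (y + l)))"
    using amalgam_le_sq_norm_lborel[OF g(1), of l] fin
    by (intro integrable_mult_sq_norm) (simp_all del: complex_cnj_mult)
  have "L2_inner f (modulation (of_int k) (translation (- l) g)) = (\<integral>y. f y * cnj (?e y * g (y + l)) \<partial>lborel)"
    by (simp add: L2_inner_def modulation_def translation_def)
  also have "\<dots> = (\<integral>x. (\<Sum>\<^sub>\<infinity>j::int. f (x - of_int j) * cnj (?e (x - of_int j) * g (x - of_int j + l))) \<partial>unit_interval)"
    by (rule integral_periodize[OF int])
  also have "\<dots> = fourier_coeff (\<lambda>x. cnj (shift_series g (fibre f x) (l + x))) k"
    unfolding fourier_coeff_def
  proof (intro Bochner_Integration.integral_cong refl)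
    fix x :: real
    have "(\<Sum>\<^sub>\<infinity>j::int. f (x - of_int j) * cnj (?e (x - of_int j) * g (x - of_int j + l)))
        = (\<Sum>\<^sub>\<infinity>j::int. cnj (fibre f x j * g (l + x - of_int j)) * cis (- (2 * pi * of_int k * x)))"
    proof (intro infsum_cong)
      fix j :: int
      have "l + x - of_int j = x - of_int j + l" by simp
      then show "f (x - of_int j) * cnj (?e (x - of_int j) * g (x - of_int j + l))
          = cnj (fibre f x j * g (l + x - of_int j)) * cis (- (2 * pi * of_int k * x))"
        by (simp only: cis_integer_shift fibre_def cis_cnj complex_cnj_mult complex_cnj_cnj) (simp only: mult_ac)
    qed
    also have "\<dots> = (\<Sum>\<^sub>\<infinity>j::int. cnj (fibre f x j * g (l + x - of_int j))) * cis (- (2 * pi * of_int k * x))"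
      by (rule infsum_cmult_left') 
    also have "\<dots> = cnj (shift_series g (fibre f x) (l + x)) * cis (- (2 * pi * of_int k * x))"
      unfolding shift_series_def infsum_cnj ..
    finally show "(\<Sum>\<^sub>\<infinity>j::int. f (x - of_int j) * cnj (?e (x - of_int j) * g (x - of_int j + l)))
        = cnj (shift_series g (fibre f x) (l + x)) * cis (- (2 * pi * of_int k * x))" .
  qed
  finally show ?thesis .
qed

text \<open>Schur's test on the one-point set \<open>{y}\<close>, which is separated with
  \<open>N = 1\<close>.\<close>

lemma cmod_shift_series_le:
  assumes "amalgam_le g W"
  shows "ennreal ((cmod (shift_series g c y))\<^sup>2) \<le> ennreal (W\<^sup>2) * sq_norm (count_space UNIV) c"
proof -
  have "card ({y} \<inter> X) \<le> 1" for X
    using card_mono[of "{y}" "{y} \<inter> X"] by simp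
  then have "separated_by 1 {y}" by (simp add: separated_by_def)
  from sampling_sum_le[OF assms this, of 0 c] show ?thesis
    by (simp add: sampling_sum_def sq_norm_def nn_integral_count_space_finite)
qed

text \<open>For each \<open>l\<close> Parseval sums out the modulations, after which Tonelli moves
  the sum over \<Lambda> inside the integral. Parseval is applicable because a sample of the shift
  series is bounded by the norm of the fibre, whose square integrates to that of
  \<open>f\<close>.\<close>

lemma gabor_sum_eq:
  assumes g: "amalgam_le g W" "continuous_on UNIV g" and \<Lambda>: "countable \<Lambda>"
    and f: "f \<in> borel_measurable borel" and fin: "sq_norm lborel f < \<infinity>"
  shows "(\<Sum>\<^sub>\<infinity>k::int. \<Sum>\<^sub>\<infinity>l\<in>\<Lambda>. ennreal ((cmod (L2_inner f (modulation (of_int k) (translation (- l) g))))\<^sup>2))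
    = (\<integral>\<^sup>+ x. sampling_sum g \<Lambda> x (fibre f x) \<partial>unit_interval)"
proof -
  let ?F = "\<lambda>l x. cnj (shift_series g (fibre f x) (l + x))"
  have [measurable]: "(\<lambda>x. shift_series g (fibre f x) (l + x)) \<in> borel_measurable unit_interval" for l
    by (rule measurable_shift_series[where c = "\<lambda>j x. fibre f x j", OF measurable_fibre[OF f] g(2)])
  have F: "?F l \<in> borel_measurable unit_interval" for l
    by measurable
  have F2: "sq_norm unit_interval (?F l) < \<infinity>" for l
  proof -
    have "sq_norm unit_interval (?F l) \<le> (\<integral>\<^sup>+ x. ennreal (W\<^sup>2) * sq_norm (count_space UNIV) (fibre f x) \<partial>unit_interval)"
      unfolding sq_norm_cnj using cmod_shift_series_le[OF g(1)]
      by (subst sq_norm_def) (intro nn_integral_mono)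
    also have "\<dots> = ennreal (W\<^sup>2) * sq_norm lborel f"
      using f by (simp add: nn_integral_cmult sq_norm_fibre)
    also have "\<dots> < \<infinity>" using fin by (simp add: ennreal_mult_less_top)
    finally show ?thesis .
  qed
  have "(\<Sum>\<^sub>\<infinity>k::int. \<Sum>\<^sub>\<infinity>l\<in>\<Lambda>. ennreal ((cmod (L2_inner f (modulation (of_int k) (translation (- l) g))))\<^sup>2))
      = (\<integral>\<^sup>+ k. \<integral>\<^sup>+ l. ennreal ((cmod (fourier_coeff (?F l) k))\<^sup>2) \<partial>count_space \<Lambda> \<partial>count_space UNIV)"
    unfolding L2_inner_eq_fourier_coeff[OF g f fin]
    by (simp add: countable_infsum_ennreal_eq_nn_integral \<Lambda>)
  also have "\<dots> = (\<integral>\<^sup>+ l. sq_norm (count_space UNIV) (fourier_coeff (?F l)) \<partial>count_space \<Lambda>)"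
    unfolding sq_norm_def using \<Lambda> by (intro nn_integral_count_space_nn_integral) simp_all
  also have "\<dots> = (\<integral>\<^sup>+ l. sq_norm unit_interval (?F l) \<partial>count_space \<Lambda>)"
    by (simp only: Parseval[OF F F2])
  also have "\<dots> = (\<integral>\<^sup>+ x. sampling_sum g \<Lambda> x (fibre f x) \<partial>unit_interval)"
    unfolding sq_norm_cnj sampling_sum_def unfolding sq_norm_def
    by (intro nn_integral_count_space_nn_integral[symmetric] \<Lambda>) measurable
  finally show ?thesis .
qed

text \<open>Integral and Zak series may be exchanged since \<open>h\<close> is integrable and the
  shifts of \<open>g\<close> sum to at most \<open>W\<close>. The exponential in \<open>Zak\<close>
  carries a positive sign, so the coefficients appear at -k and the index is reflected at the
  end.\<close>

lemma integral_mult_Zak: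
  assumes g: "amalgam_le g W" "continuous_on UNIV g"
    and h [measurable]: "h \<in> borel_measurable unit_interval" and fin: "sq_norm unit_interval h < \<infinity>"
  shows "(LBINT \<xi>:{0..1}. h \<xi> * Zak g y \<xi>) = shift_series g (fourier_coeff h) y"
proof -
  have hi: "integrable unit_interval h"
    by (rule sq_norm_finite_imp_integrable[OF h fin finite_measure_unit_interval])
  let ?\<phi> = "\<lambda>(k::int) \<xi>. h \<xi> * (g (y + of_int k) * cis (2 * pi * of_int k * \<xi>))"
  have meas: "(\<lambda>(k, \<xi>). ?\<phi> k \<xi>) \<in> borel_measurable (count_space UNIV \<Otimes>\<^sub>M unit_interval)"
    unfolding split_beta' by (intro measurable_pair_measure_countable1) simp_all
  have int: "integrable (count_space UNIV \<Otimes>\<^sub>M unit_interval) (\<lambda>(k, \<xi>). ?\<phi> k \<xi>)"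
  proof (rule integrableI_bounded[OF meas])
    let ?I = "\<integral>\<^sup>+ \<xi>. ennreal (cmod (h \<xi>)) \<partial>unit_interval"
    have "(\<integral>\<^sup>+ p. ennreal (norm (case p of (k, \<xi>) \<Rightarrow> ?\<phi> k \<xi>)) \<partial>(count_space UNIV \<Otimes>\<^sub>M unit_interval))
        = (\<integral>\<^sup>+ k. \<integral>\<^sup>+ \<xi>. ennreal (norm (?\<phi> k \<xi>)) \<partial>unit_interval \<partial>count_space UNIV)"
      using meas by (subst unit_interval.nn_integral_fst[symmetric]) (simp_all add: split_beta')
    also have "\<dots> = (\<integral>\<^sup>+ k. ?I * ennreal (cmod (g (y + of_int k))) \<partial>count_space UNIV)"
      by (simp add: norm_mult ennreal_mult nn_integral_multc)
    also have "\<dots> = ?I * (\<integral>\<^sup>+ k. ennreal (cmod (g (y + of_int k))) \<partial>count_space UNIV)"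
      by (rule nn_integral_cmult) simp
    also have "(\<integral>\<^sup>+ k. ennreal (cmod (g (y + of_int k))) \<partial>count_space UNIV) \<le> ennreal W"
      using amalgam_le_sum_shifts[OF g(1), of y]
        nn_integral_count_space_reflect[of "\<lambda>k. ennreal (cmod (g (y + of_int k)))" 0] by simp
    then have "?I * (\<integral>\<^sup>+ k. ennreal (cmod (g (y + of_int k))) \<partial>count_space UNIV) \<le> ?I * ennreal W"
      by (intro mult_left_mono) auto
    also have "\<dots> < \<infinity>"
      using hi by (simp add: integrable_iff_bounded ennreal_mult_less_top)
    finally show "(\<integral>\<^sup>+ p. ennreal (norm (case p of (k, \<xi>) \<Rightarrow> ?\<phi> k \<xi>)) \<partial>(count_space UNIV \<Otimes>\<^sub>M unit_interval)) < \<infinity>" .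
  qed
  have "(LBINT \<xi>:{0..1}. h \<xi> * Zak g y \<xi>) = (\<integral>\<xi>. h \<xi> * Zak g y \<xi> \<partial>unit_interval)"
    by (simp add: set_lebesgue_integral_def integral_restrict_space)
  also have "\<dots> = (\<integral>\<xi>. (\<integral>k. ?\<phi> k \<xi> \<partial>count_space UNIV) \<partial>unit_interval)"
    by (simp only: Zak_def infsum_eq_integral_count_space integral_mult_right_zero)
  also have "\<dots> = (\<integral>k. (\<integral>\<xi>. ?\<phi> k \<xi> \<partial>unit_interval) \<partial>count_space UNIV)"
    using periodization.Fubini_integral[OF int] by simp
  also have "\<dots> = (\<integral>k. fourier_coeff h (- k) * g (y + of_int k) \<partial>count_space UNIV)"
  proof (intro Bochner_Integration.integral_cong refl)
    fix k :: int
    have "(\<integral>\<xi>. ?\<phi> k \<xi> \<partial>unit_interval) = (\<integral>\<xi>. g (y + of_int k) * (h \<xi> * cis (- (2 * pi * of_int (- k) * \<xi>))) \<partial>unit_interval)"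
      by (intro Bochner_Integration.integral_cong) (simp_all add: mult_ac)
    also have "\<dots> = g (y + of_int k) * fourier_coeff h (- k)"
      unfolding fourier_coeff_def by (rule integral_mult_right_zero)
    finally show "(\<integral>\<xi>. ?\<phi> k \<xi> \<partial>unit_interval) = fourier_coeff h (- k) * g (y + of_int k)"
      by (simp add: mult.commute)
  qed
  also have "\<dots> = shift_series g (fourier_coeff h) y"
  proof -
    have "bij_betw uminus (UNIV :: int set) UNIV" by (rule bij_betwI[where g=uminus]) auto
    from infsum_reindex_bij_betw[OF this, of "\<lambda>k. fourier_coeff h k * g (y - of_int k)"]
    show ?thesis by (simp add: shift_series_def infsum_eq_integral_count_space)
  qed
  finally show ?thesis .
qed

section \<open>Frame bounds\<close>

text \<open>The two halves are kept apart because compactness is applied to the lower one only, and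
  the two optimal constants are found independently of each other.\<close>

definition lower_bound :: "(real \<Rightarrow> complex) \<Rightarrow> real set \<Rightarrow> real \<Rightarrow> real \<Rightarrow> bool" where
  "lower_bound g \<Lambda> x A \<longleftrightarrow> (\<forall>c. sq_norm (count_space UNIV) c < \<infinity> \<longrightarrow>
     ennreal A * sq_norm (count_space UNIV) c \<le> sampling_sum g \<Lambda> x c)"

definition upper_bound :: "(real \<Rightarrow> complex) \<Rightarrow> real set \<Rightarrow> real \<Rightarrow> real \<Rightarrow> bool" where
  "upper_bound g \<Lambda> x B \<longleftrightarrow> (\<forall>c. sq_norm (count_space UNIV) c < \<infinity> \<longrightarrow>
     sampling_sum g \<Lambda> x c \<le> ennreal B * sq_norm (count_space UNIV) c)"

lemma sampling_bounds_iff: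
  assumes "countable \<Lambda>"
  shows "sampling_bounds g \<Lambda> x A B \<longleftrightarrow> A > 0 \<and> B > 0 \<and> lower_bound g \<Lambda> x A \<and> upper_bound g \<Lambda> x B"
  unfolding sampling_bounds_def lower_bound_def upper_bound_def Lp_space_2 Lp_norm_2_squared
    countable_infsum_ennreal_eq_nn_integral[OF assms] Let_def
  by (auto simp: sampling_sum_def sq_norm_def)

lemma sampling_sum_zero [simp]: "sampling_sum g \<Lambda> x (\<lambda>_. 0) = 0"
  by (simp add: sampling_sum_def sq_norm_def shift_series_def)

lemma sq_norm_zero [simp]: "sq_norm M (\<lambda>_. 0) = 0"
  by (simp add: sq_norm_def)

lemma sq_norm_finite_support:
  assumes "finite F" "\<And>k. k \<notin> F \<Longrightarrow> c k = 0"
  shows "sq_norm (count_space UNIV) c = ennreal (\<Sum>k\<in>F. (cmod (c k))\<^sup>2)"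
  unfolding sq_norm_def using assms by (subst nn_integral_count_space'[where A=F]) auto

text \<open>This is where perturbation errors disappear and exact constants return: for finite
  \<open>b\<close> and \<open>d\<close> the excess is \<eta> times their sum, which falls below any
  given \<open>e\<close>.\<close>

lemma ennreal_le_of_perturbation:
  assumes "b < \<infinity>" "d < \<infinity>"
    and le: "\<And>\<eta>. 0 < \<eta> \<Longrightarrow> a \<le> ennreal (1 + \<eta>) * b + ennreal \<eta> * d"
  shows "a \<le> b"
proof (rule ennreal_le_epsilon)
  fix e :: real assume e: "0 < e"
  obtain b' d' where b: "b = ennreal b'" "0 \<le> b'" and d: "d = ennreal d'" "0 \<le> d'"
    using assms(1,2) by (metis ennreal_cases infinity_ennreal_def less_irrefl)
  define \<eta> where "\<eta> = e / (b' + d' + 1)"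
  have \<eta>: "0 < \<eta>" using e b d by (simp add: \<eta>_def)
  have "a \<le> ennreal (1 + \<eta>) * b + ennreal \<eta> * d" by (rule le[OF \<eta>])
  also have "\<dots> = ennreal ((1 + \<eta>) * b' + \<eta> * d')"
    using b d \<eta> by (simp add: ennreal_mult ennreal_plus[symmetric] del: ennreal_plus flip: ennreal_mult)
  also have "(1 + \<eta>) * b' + \<eta> * d' \<le> b' + e"
  proof -
    have "\<eta> * (b' + d') \<le> \<eta> * (b' + d' + 1)" using \<eta> by (intro mult_left_mono) auto
    also have "\<dots> = e" using b d by (simp add: \<eta>_def)
    finally show ?thesis by (simp add: algebra_simps)
  qed
  then have "ennreal ((1 + \<eta>) * b' + \<eta> * d') \<le> ennreal (b' + e)" by (rule ennreal_leI)
  also have "ennreal (b' + e) = b + ennreal e" using b e by simp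
  finally show "a \<le> b + ennreal e" .
qed

section \<open>Gabor bounds and uniform sampling bounds\<close>

lemma sampling_sum_finite:
  assumes "amalgam_le g W" "separated_by N \<Lambda>" "sq_norm (count_space UNIV) c < \<infinity>"
  shows "sampling_sum g \<Lambda> x c < \<infinity>"
  using sampling_sum_le[OF assms(1,2), of x c] assms(3)
  by (auto simp: ennreal_mult_less_top intro: le_less_trans)

lemma gabor_frame_bounds_of_uniform:
  assumes g: "g \<in> wiener_space" and sep: "separated_by N \<Lambda>"
    and unif: "uniform_sampling_bounds g \<Lambda> A B"
  shows "gabor_frame_bounds g \<Lambda> A B"
proof -
  obtain W where W: "amalgam_le g W" using wiener_space_amalgam[OF g] by blast
  have cont: "continuous_on UNIV g" using g by (simp add: wiener_space_def)
  note \<Lambda> = separated_by_countable[OF sep]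
  have AB: "A > 0" "B > 0" and low: "\<And>x. x \<in> {0..<1} \<Longrightarrow> lower_bound g \<Lambda> x A"
    and up: "\<And>x. x \<in> {0..<1} \<Longrightarrow> upper_bound g \<Lambda> x B"
    using unif unfolding uniform_sampling_bounds_def sampling_bounds_iff[OF \<Lambda>]
    by (auto dest: bspec[of _ _ 0])
  show ?thesis
    unfolding gabor_frame_bounds_def Let_def Lp_norm_2_squared
  proof (intro conjI ballI AB)
    fix f :: "real \<Rightarrow> complex" assume "f \<in> Lp_space 2 lborel"
    then have f: "f \<in> borel_measurable borel" and fin: "sq_norm lborel f < \<infinity>"
      by (auto simp: Lp_space_2)
    note S = gabor_sum_eq[OF W cont \<Lambda> f fin]
    \<comment> \<open>Two null sets are discarded: the endpoint 1, which lies in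
      \<open>unit_interval\<close> but outside the range of admissible translations, and the points
      whose fibre is not square-summable.\<close>
    have ae: "AE x in unit_interval. x \<in> {0..<1} \<and> sq_norm (count_space UNIV) (fibre f x) < \<infinity>"
    proof -
      have "AE x in lborel. x \<noteq> (1::real)" by (rule AE_lborel_singleton)
      then have "AE x in unit_interval. x \<in> {0..<1}"
        unfolding AE_unit_interval_iff by eventually_elim auto
      with AE_sq_norm_fibre_finite[OF f fin] show ?thesis by eventually_elim simp
    qed
    show "ennreal A * sq_norm lborel f \<le> (\<Sum>\<^sub>\<infinity>k::int. \<Sum>\<^sub>\<infinity>l\<in>\<Lambda>.
        ennreal ((cmod (L2_inner f (modulation (of_int k) (translation (- l) g))))\<^sup>2))"
    proof -
      have "ennreal A * sq_norm lborel f = (\<integral>\<^sup>+ x. ennreal A * sq_norm (count_space UNIV) (fibre f x) \<partial>unit_interval)"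
        using f by (simp add: sq_norm_fibre nn_integral_cmult)
      also have "\<dots> \<le> (\<integral>\<^sup>+ x. sampling_sum g \<Lambda> x (fibre f x) \<partial>unit_interval)"
      proof (rule nn_integral_mono_AE)
        show "AE x in unit_interval. ennreal A * sq_norm (count_space UNIV) (fibre f x) \<le> sampling_sum g \<Lambda> x (fibre f x)"
          using ae by eventually_elim (use low in \<open>auto simp: lower_bound_def\<close>)
      qed
      finally show ?thesis unfolding S .
    qed
    show "(\<Sum>\<^sub>\<infinity>k::int. \<Sum>\<^sub>\<infinity>l\<in>\<Lambda>.
        ennreal ((cmod (L2_inner f (modulation (of_int k) (translation (- l) g))))\<^sup>2)) \<le> ennreal B * sq_norm lborel f"
    proof -
      have "(\<integral>\<^sup>+ x. sampling_sum g \<Lambda> x (fibre f x) \<partial>unit_interval)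
          \<le> (\<integral>\<^sup>+ x. ennreal B * sq_norm (count_space UNIV) (fibre f x) \<partial>unit_interval)"
      proof (rule nn_integral_mono_AE)
        show "AE x in unit_interval. sampling_sum g \<Lambda> x (fibre f x) \<le> ennreal B * sq_norm (count_space UNIV) (fibre f x)"
          using ae by eventually_elim (use up in \<open>auto simp: upper_bound_def\<close>)
      qed
      also have "\<dots> = ennreal B * sq_norm lborel f"
        using f by (simp add: sq_norm_fibre nn_integral_cmult)
      finally show ?thesis unfolding S .
    qed
  qed
qed

text \<open>Such an \<open>f\<close> is constant on a piece of length \<delta> in each integer cell.
  The cell with floor -j carries the conjugate of \<open>c j\<close>, which \<open>fibre\<close>
  undoes. The identity is claimed almost everywhere because at x = 1 the floor jumps.\<close>

lemma localized_fibre: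
  assumes I: "0 \<le> a" "0 < \<delta>" "a + \<delta> \<le> 1" and c: "sq_norm (count_space UNIV) c < \<infinity>"
  obtains f where "f \<in> borel_measurable borel"
    "sq_norm lborel f = ennreal \<delta> * sq_norm (count_space UNIV) c"
    "AE x in unit_interval. fibre f x = (if x \<in> {a..<a + \<delta>} then c else (\<lambda>_. 0))"
proof -
  define f where "f y = (if a \<le> frac y \<and> frac y < a + \<delta> then cnj (c (- \<lfloor>y\<rfloor>)) else 0)" for y
  have c_meas: "(\<lambda>y::real. cnj (c (- \<lfloor>y\<rfloor>))) \<in> borel_measurable borel"
    by (rule measurable_compose[OF measurable_real_floor]) simp
  have meas: "f \<in> borel_measurable borel"
    unfolding f_def frac_def using c_meas by measurable
  have "AE x in lborel. x \<noteq> (1::real)" by (rule AE_lborel_singleton)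
  then have ae: "AE x in unit_interval. fibre f x = (if x \<in> {a..<a + \<delta>} then c else (\<lambda>_. 0))"
    unfolding AE_unit_interval_iff
  proof eventually_elim
    fix x :: real assume "x \<noteq> 1"
    show "x \<in> {0..1} \<longrightarrow> fibre f x = (if x \<in> {a..<a + \<delta>} then c else (\<lambda>_. 0))"
    proof
      assume "x \<in> {0..1}"
      then have x: "0 \<le> x" "x < 1" using \<open>x \<noteq> 1\<close> by auto
      have "\<lfloor>x - of_int j\<rfloor> = - j" for j using x by (simp add: floor_eq_iff)
      moreover from this have "frac (x - of_int j) = x" for j by (simp add: frac_def)
      ultimately show "fibre f x = (if x \<in> {a..<a + \<delta>} then c else (\<lambda>_. 0))"
        by (auto simp: fibre_def f_def fun_eq_iff)
    qed
  qed
  have "sq_norm lborel f = (\<integral>\<^sup>+ x. sq_norm (count_space UNIV) c * indicator {a..<a + \<delta>} x \<partial>unit_interval)"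
    unfolding sq_norm_fibre[OF meas]
  proof (rule nn_integral_cong_AE)
    show "AE x in unit_interval. sq_norm (count_space UNIV) (fibre f x) = sq_norm (count_space UNIV) c * indicator {a..<a + \<delta>} x"
      using ae by eventually_elim auto
  qed
  also have "\<dots> = ennreal \<delta> * sq_norm (count_space UNIV) c"
  proof -
    have "{a..<a + \<delta>} \<subseteq> {0..1}" using I by auto
    then have "emeasure unit_interval {a..<a + \<delta>} = ennreal \<delta>"
      using I by (subst emeasure_restrict_space) auto
    moreover have "{a..<a + \<delta>} \<in> sets unit_interval"
      using I by (auto simp: sets_restrict_space_iff)
    ultimately show ?thesis by (subst nn_integral_cmult_indicator) (auto simp: mult.commute)
  qed
  finally show ?thesis using that meas ae by blast
qed

text \<open>Test functions over a short interval starting at \<open>a\<close> turn the frame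
  inequality into one for the integral of S over that interval. Continuity replaces S by its value
  at \<open>a\<close> up to \<eta>, and the length \<delta> cancels on both sides.\<close>

lemma uniform_of_gabor_frame_bounds:
  assumes g: "g \<in> wiener_space" and sep: "separated_by N \<Lambda>"
    and gab: "gabor_frame_bounds g \<Lambda> A B"
  shows "uniform_sampling_bounds g \<Lambda> A B"
proof -
  obtain W where W: "amalgam_le g W" using wiener_space_amalgam[OF g] by blast
  have cont: "continuous_on UNIV g" using g by (simp add: wiener_space_def)
  note \<Lambda> = separated_by_countable[OF sep]
  have AB: "A > 0" "B > 0" using gab by (simp_all add: gabor_frame_bounds_def)
  have key: "ennreal A * n \<le> ennreal (1 + \<eta>) * sampling_sum g \<Lambda> a c + ennreal \<eta> * n \<and>
      sampling_sum g \<Lambda> a c \<le> ennreal (1 + \<eta>) * (ennreal B * n) + ennreal \<eta> * n"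
    if a: "a \<in> {0..<1}" and c: "sq_norm (count_space UNIV) c < \<infinity>" and \<eta>: "0 < \<eta>"
      and n: "n = sq_norm (count_space UNIV) c" for a \<eta> c n
  proof -
    obtain \<delta>0 where \<delta>0: "0 < \<delta>0" and near: "\<And>x y. \<bar>x - y\<bar> < \<delta>0 \<Longrightarrow>
      sampling_sum g \<Lambda> x c \<le> ennreal (1 + \<eta>) * sampling_sum g \<Lambda> y c + ennreal \<eta> * n"
      unfolding n by (rule sampling_sum_continuous[OF g sep \<eta>]) (use c in blast)
    \<comment> \<open>The interval extends only to the right of \<open>a\<close>, so
      \<open>a = 0\<close> needs no special treatment, and it is cut off at 1.\<close>
    define \<delta> where "\<delta> = min \<delta>0 (1 - a)"
    have \<delta>: "0 < \<delta>" "\<delta> \<le> \<delta>0" "a + \<delta> \<le> 1" using a \<delta>0 by (auto simp: \<delta>_def)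
    let ?I = "{a..<a + \<delta>}"
    obtain f where f: "f \<in> borel_measurable borel" and fn: "sq_norm lborel f = ennreal \<delta> * n"
      and fib: "AE x in unit_interval. fibre f x = (if x \<in> ?I then c else (\<lambda>_. 0))"
      using localized_fibre[OF _ \<delta>(1,3) c] a unfolding n by auto
    have fin: "sq_norm lborel f < \<infinity>" using c unfolding fn n by (simp add: ennreal_mult_less_top)
    have [measurable]: "?I \<in> sets unit_interval" "?I \<inter> {0..1} = ?I"
      using a \<delta> by (auto simp: sets_restrict_space_iff)
    have mI: "emeasure unit_interval ?I = ennreal \<delta>"
      using a \<delta> by (subst emeasure_restrict_space) auto
    let ?S = "\<integral>\<^sup>+ x. sampling_sum g \<Lambda> x c * indicator ?I x \<partial>unit_interval"
    have const: "(\<integral>\<^sup>+ x. m * indicator ?I x \<partial>unit_interval) = ennreal \<delta> * m" for m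
      by (subst nn_integral_cmult_indicator) (simp_all add: mI mult.commute)
    have "(\<integral>\<^sup>+ x. sampling_sum g \<Lambda> x (fibre f x) \<partial>unit_interval) = ?S"
    proof (rule nn_integral_cong_AE)
      show "AE x in unit_interval. sampling_sum g \<Lambda> x (fibre f x) = sampling_sum g \<Lambda> x c * indicator ?I x"
        using fib by eventually_elim auto
    qed
    note S_eq = gabor_sum_eq[OF W cont \<Lambda> f fin, unfolded this]
    have "f \<in> Lp_space 2 lborel" using f fin by (simp add: Lp_space_2)
    then have S: "ennreal A * (ennreal \<delta> * n) \<le> ?S" "?S \<le> ennreal B * (ennreal \<delta> * n)"
      using gab unfolding gabor_frame_bounds_def Let_def Lp_norm_2_squared S_eq[symmetric] fn[symmetric]
      by blast+
    have meas: "(\<lambda>x. sampling_sum g \<Lambda> x c) \<in> borel_measurable unit_interval"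
    proof -
      have [measurable]: "(\<lambda>x. shift_series g c (l + x)) \<in> borel_measurable unit_interval" for l
        using measurable_shift_series[of "\<lambda>j x. c j", OF _ cont] by simp
      show ?thesis unfolding sampling_sum_def sq_norm_def
        by (intro borel_measurable_nn_integral_count_space \<Lambda>) measurable
    qed
    have \<delta>_cancel: "u \<le> v" if "ennreal \<delta> * u \<le> ennreal \<delta> * v" for u v
      using that \<delta>(1) by (simp add: ennreal_mult_le_mult_iff)
    have "ennreal A * (ennreal \<delta> * n) \<le> (\<integral>\<^sup>+ x. (ennreal (1 + \<eta>) * sampling_sum g \<Lambda> a c + ennreal \<eta> * n) * indicator ?I x \<partial>unit_interval)"
      using S(1)
    proof (rule order_trans)
      show "?S \<le> (\<integral>\<^sup>+ x. (ennreal (1 + \<eta>) * sampling_sum g \<Lambda> a c + ennreal \<eta> * n) * indicator ?I x \<partial>unit_interval)"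
      proof (intro nn_integral_mono)
        fix x :: real
        show "sampling_sum g \<Lambda> x c * indicator ?I x \<le> (ennreal (1 + \<eta>) * sampling_sum g \<Lambda> a c + ennreal \<eta> * n) * indicator ?I x"
        proof (cases "x \<in> ?I")
          case True
          then have "\<bar>x - a\<bar> < \<delta>0" using \<delta> by auto
          from near[OF this] True show ?thesis by simp
        qed simp
      qed
    qed
    also have "\<dots> = ennreal \<delta> * (ennreal (1 + \<eta>) * sampling_sum g \<Lambda> a c + ennreal \<eta> * n)"
      by (rule const)
    finally have "ennreal \<delta> * (ennreal A * n) \<le> ennreal \<delta> * (ennreal (1 + \<eta>) * sampling_sum g \<Lambda> a c + ennreal \<eta> * n)"
      by (simp only: mult.left_commute)
    then have 1: "ennreal A * n \<le> ennreal (1 + \<eta>) * sampling_sum g \<Lambda> a c + ennreal \<eta> * n"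
      by (rule \<delta>_cancel)
    have "ennreal \<delta> * sampling_sum g \<Lambda> a c = (\<integral>\<^sup>+ x. sampling_sum g \<Lambda> a c * indicator ?I x \<partial>unit_interval)"
      by (rule const[symmetric])
    \<comment> \<open>The upper bound uses the same continuity estimate with the roles of
      \<open>a\<close> and x exchanged.\<close>
    also have "\<dots> \<le> (\<integral>\<^sup>+ x. ennreal (1 + \<eta>) * (sampling_sum g \<Lambda> x c * indicator ?I x) + ennreal \<eta> * n * indicator ?I x \<partial>unit_interval)"
    proof (intro nn_integral_mono)
      fix x :: real
      show "sampling_sum g \<Lambda> a c * indicator ?I x \<le> ennreal (1 + \<eta>) * (sampling_sum g \<Lambda> x c * indicator ?I x) + ennreal \<eta> * n * indicator ?I x"
      proof (cases "x \<in> ?I")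
        case True
        then have "\<bar>a - x\<bar> < \<delta>0" using \<delta> by auto
        from near[OF this] True show ?thesis by simp
      qed simp
    qed
    also have "\<dots> = ennreal (1 + \<eta>) * ?S + ennreal \<delta> * (ennreal \<eta> * n)"
      using meas by (subst nn_integral_add) (simp_all add: nn_integral_cmult const)
    also have "\<dots> \<le> ennreal (1 + \<eta>) * (ennreal B * (ennreal \<delta> * n)) + ennreal \<delta> * (ennreal \<eta> * n)"
      by (intro add_right_mono mult_left_mono S(2)) simp
    also have "\<dots> = ennreal \<delta> * (ennreal (1 + \<eta>) * (ennreal B * n) + ennreal \<eta> * n)"
      by (simp only: distrib_left mult.left_commute)
    finally have 2: "sampling_sum g \<Lambda> a c \<le> ennreal (1 + \<eta>) * (ennreal B * n) + ennreal \<eta> * n"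
      by (rule \<delta>_cancel)
    show ?thesis using 1 2 by simp
  qed
  show ?thesis
    unfolding uniform_sampling_bounds_def sampling_bounds_iff[OF \<Lambda>]
  proof (intro ballI conjI AB)
    fix a :: real assume a: "a \<in> {0..<1}"
    show "lower_bound g \<Lambda> a A"
      unfolding lower_bound_def
    proof (intro allI impI)
      fix c :: "int \<Rightarrow> complex" assume c: "sq_norm (count_space UNIV) c < \<infinity>"
      show "ennreal A * sq_norm (count_space UNIV) c \<le> sampling_sum g \<Lambda> a c"
        by (rule ennreal_le_of_perturbation[OF sampling_sum_finite[OF W sep c] c]) (use key[OF a c] in blast)
    qed
    show "upper_bound g \<Lambda> a B"
      unfolding upper_bound_def
    proof (intro allI impI)
      fix c :: "int \<Rightarrow> complex" assume c: "sq_norm (count_space UNIV) c < \<infinity>"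
      have "ennreal B * sq_norm (count_space UNIV) c < \<infinity>" using c by (simp add: ennreal_mult_less_top)
      then show "sampling_sum g \<Lambda> a c \<le> ennreal B * sq_norm (count_space UNIV) c"
        by (rule ennreal_le_of_perturbation[OF _ c]) (use key[OF a c] in blast)
    qed
  qed
qed

section \<open>Zak bounds and uniform sampling bounds\<close>

lemma Zak_sum_eq:
  assumes "amalgam_le g W" "continuous_on UNIV g" "countable \<Lambda>"
    and "h \<in> borel_measurable unit_interval" "sq_norm unit_interval h < \<infinity>"
  shows "(\<Sum>\<^sub>\<infinity>l\<in>\<Lambda>. ennreal ((cmod (LBINT \<xi>:{0..1}. h \<xi> * Zak g (x + l) \<xi>))\<^sup>2)) =
    sampling_sum g \<Lambda> x (fourier_coeff h)"
  unfolding integral_mult_Zak[OF assms(1,2,4,5)] countable_infsum_ennreal_eq_nn_integral[OF assms(3)]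
  by (simp add: sampling_sum_def sq_norm_def add.commute)

lemma Zak_bounds_of_uniform:
  assumes g: "g \<in> wiener_space" and sep: "separated_by N \<Lambda>"
    and unif: "uniform_sampling_bounds g \<Lambda> A B"
  shows "Zak_bounds g \<Lambda> A B"
proof -
  obtain W where W: "amalgam_le g W" using wiener_space_amalgam[OF g] by blast
  have cont: "continuous_on UNIV g" using g by (simp add: wiener_space_def)
  note \<Lambda> = separated_by_countable[OF sep]
  have AB: "A > 0" "B > 0" and low: "\<And>x. x \<in> {0..<1} \<Longrightarrow> lower_bound g \<Lambda> x A"
    and up: "\<And>x. x \<in> {0..<1} \<Longrightarrow> upper_bound g \<Lambda> x B"
    using unif unfolding uniform_sampling_bounds_def sampling_bounds_iff[OF \<Lambda>]
    by (auto dest: bspec[of _ _ 0])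
  show ?thesis
    unfolding Zak_bounds_def Let_def Lp_norm_2_squared Lp_space_2
  proof (intro conjI ballI AB)
    fix h :: "real \<Rightarrow> complex" and x :: real
    assume "h \<in> {h \<in> borel_measurable unit_interval. sq_norm unit_interval h < \<infinity>}" and x: "x \<in> {0..<1}"
    then have h: "h \<in> borel_measurable unit_interval" "sq_norm unit_interval h < \<infinity>" by auto
    note P = Parseval[OF h]
    have "sq_norm (count_space UNIV) (fourier_coeff h) < \<infinity>" using h(2) unfolding P .
    then show "ennreal A * sq_norm unit_interval h \<le>
        (\<Sum>\<^sub>\<infinity>l\<in>\<Lambda>. ennreal ((cmod (LBINT \<xi>:{0..1}. h \<xi> * Zak g (x + l) \<xi>))\<^sup>2))"
      and "(\<Sum>\<^sub>\<infinity>l\<in>\<Lambda>. ennreal ((cmod (LBINT \<xi>:{0..1}. h \<xi> * Zak g (x + l) \<xi>))\<^sup>2))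
        \<le> ennreal B * sq_norm unit_interval h"
      using low[OF x] up[OF x] unfolding Zak_sum_eq[OF W cont \<Lambda> h] P[symmetric] lower_bound_def upper_bound_def
      by blast+
  qed
qed

lemma sq_norm_tail_small:
  fixes c :: "int \<Rightarrow> complex"
  assumes c: "sq_norm (count_space UNIV) c < \<infinity>" and \<epsilon>: "0 < \<epsilon>"
  obtains F where "finite F" "sq_norm (count_space UNIV) (\<lambda>k. if k \<in> F then 0 else c k) \<le> ennreal \<epsilon>"
proof -
  let ?d = "\<lambda>k. (cmod (c k))\<^sup>2"
  have "integrable (count_space UNIV) ?d"
    using c by (intro integrableI_bounded) (auto simp: sq_norm_def)
  then have "Infinite_Set_Sum.abs_summable_on ?d UNIV" by (simp add: Infinite_Set_Sum.abs_summable_on_def)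
  then have d: "?d summable_on UNIV"
    unfolding abs_summable_equivalent[symmetric] by (rule abs_summable_summable)
  obtain F where F: "finite F" "infsum ?d (- F) \<le> \<epsilon>" using summable_finite_tail[OF d \<epsilon>] by blast
  let ?a = "\<lambda>k. if k \<in> F then 0 else ?d k"
  have "?d summable_on - F" using d by (rule summable_on_subset_banach) auto
  then have a: "?a summable_on UNIV" "infsum ?a UNIV = infsum ?d (- F)"
    using summable_on_cong_neutral[of "- F" UNIV ?d ?a] infsum_cong_neutral[of "- F" UNIV ?d ?a] by auto
  have "sq_norm (count_space UNIV) (\<lambda>k. if k \<in> F then 0 else c k) = (\<integral>\<^sup>+ k. ennreal (?a k) \<partial>count_space UNIV)"
    unfolding sq_norm_def by (intro nn_integral_cong) simp
  also have "\<dots> = ennreal (infsum ?a UNIV)"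
    using a(1) by (intro nn_integral_count_space_summable) auto
  also have "\<dots> \<le> ennreal \<epsilon>" using F a by (intro ennreal_leI) simp
  finally show ?thesis using that F(1) by blast
qed

text \<open>For \<open>h\<close> a trigonometric polynomial, Parseval and the coefficient formula
  give both inequalities with unchanged constants. A general \<open>c\<close> is cut at a finite
  set, and the weighted square estimate transfers each inequality with an arbitrarily small absolute
  error.\<close>

lemma uniform_of_Zak_bounds:
  assumes g: "g \<in> wiener_space" and sep: "separated_by N \<Lambda>"
    and zak: "Zak_bounds g \<Lambda> A B"
  shows "uniform_sampling_bounds g \<Lambda> A B"
proof -
  obtain W where W: "amalgam_le g W" using wiener_space_amalgam[OF g] by blast
  have cont: "continuous_on UNIV g" using g by (simp add: wiener_space_def)
  note \<Lambda> = separated_by_countable[OF sep]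
  have AB: "A > 0" "B > 0" using zak by (simp_all add: Zak_bounds_def)
  let ?n = "sq_norm (count_space (UNIV :: int set))"
  have fin_supp: "ennreal A * ?n c \<le> sampling_sum g \<Lambda> a c \<and> sampling_sum g \<Lambda> a c \<le> ennreal B * ?n c"
    if a: "a \<in> {0..<1}" and F: "finite F" and c: "\<And>k. k \<notin> F \<Longrightarrow> c k = 0" for a F c
  proof -
    have fc: "fourier_coeff (trig_poly c F) = c"
      using c by (auto simp: fourier_coeff_trig_poly[OF F] fun_eq_iff)
    have fin: "sq_norm unit_interval (trig_poly c F) < \<infinity>"
    proof -
      have "cmod (trig_poly c F \<xi>) \<le> (\<Sum>k\<in>F. cmod (c k))" for \<xi>
        unfolding trig_poly_def by (rule order_trans[OF norm_sum]) (simp add: norm_mult)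
      then have "sq_norm unit_interval (trig_poly c F) \<le> (\<integral>\<^sup>+ \<xi>. ennreal ((\<Sum>k\<in>F. cmod (c k))\<^sup>2) \<partial>unit_interval)"
        unfolding sq_norm_def by (intro nn_integral_mono ennreal_leI power_mono) auto
      also have "\<dots> < \<infinity>" by (simp add: emeasure_restrict_space ennreal_mult_less_top)
      finally show ?thesis .
    qed
    have "trig_poly c F \<in> Lp_space 2 unit_interval" using fin by (simp add: Lp_space_2)
    then show ?thesis
      using zak a unfolding Zak_bounds_def Let_def Lp_norm_2_squared
      by (auto simp: Zak_sum_eq[OF W cont \<Lambda> _ fin] fc Parseval[OF _ fin, symmetric])
  qed
  have key: "ennreal A * ?n c \<le> ennreal (1 + \<eta>) * sampling_sum g \<Lambda> a c + ennreal \<eta> * 1 \<and>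
      sampling_sum g \<Lambda> a c \<le> ennreal (1 + \<eta>) * (ennreal B * ?n c) + ennreal \<eta> * 1"
    if a: "a \<in> {0..<1}" and c: "?n c < \<infinity>" and \<eta>: "0 < \<eta>" for a \<eta> c
  proof -
    define K where "K = real N * W\<^sup>2"
    \<comment> \<open>Collects everything the tail costs per unit of its squared norm: Schur's
      constant with the weight of the error term, and \<open>A\<close> for the tail missing on the
      left of the lower bound. With \<open>\<epsilon> = \<eta> / L\<close> the total cost is exactly
      \<eta>.\<close>
    define L where "L = (1 + 1 / \<eta>) * K + A"
    have K: "0 \<le> K" by (simp add: K_def)
    have L: "0 < L" using K AB \<eta> by (simp add: L_def add_nonneg_pos)
    define \<epsilon> where "\<epsilon> = \<eta> / L"
    have \<epsilon>: "0 < \<epsilon>" using L \<eta> by (simp add: \<epsilon>_def)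
    obtain F where F: "finite F" and tail: "?n (\<lambda>k. if k \<in> F then 0 else c k) \<le> ennreal \<epsilon>"
      using sq_norm_tail_small[OF c \<epsilon>] .
    define c1 where "c1 k = (if k \<in> F then c k else 0)" for k
    define c2 where "c2 k = (if k \<in> F then 0 else c k)" for k
    \<comment> \<open>The negative tail: the upper bound expands \<open>c\<close> as
      \<open>c1\<close> plus the tail, the lower bound expands \<open>c1\<close> as \<open>c\<close>
      minus the tail.\<close>
    define c3 where "c3 k = (if k \<in> F then 0 else - c k)" for k
    have n2: "?n c2 \<le> ennreal \<epsilon>" using tail by (simp add: c2_def[abs_def])
    have n3: "?n c3 = ?n c2" unfolding sq_norm_def c2_def c3_def by (intro nn_integral_cong) simp
    have n_split: "?n c = ?n c1 + ?n c2"
      unfolding sq_norm_def c1_def c2_def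
      by (subst nn_integral_add[symmetric]) (auto intro!: nn_integral_cong)
    have fin: "?n c1 < \<infinity>" "?n c2 < \<infinity>" "?n c3 < \<infinity>" using c n3 by (simp_all add: n_split)
    have c1: "c1 = (\<lambda>k. c k + c3 k)" and c_eq: "c = (\<lambda>k. c1 k + c2 k)"
      by (auto simp: c1_def c2_def c3_def)
    note f1 = fin_supp[OF a F, of c1]
    have err: "ennreal (1 + 1 / \<eta>) * sampling_sum g \<Lambda> a d \<le> ennreal ((1 + 1 / \<eta>) * K * \<epsilon>)"
      if "?n d \<le> ennreal \<epsilon>" for d
    proof -
      have "sampling_sum g \<Lambda> a d \<le> ennreal K * ?n d" unfolding K_def by (rule sampling_sum_le[OF W sep])
      also have "\<dots> \<le> ennreal K * ennreal \<epsilon>" using that by (rule mult_left_mono) simp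
      finally have "ennreal (1 + 1 / \<eta>) * sampling_sum g \<Lambda> a d \<le> ennreal (1 + 1 / \<eta>) * (ennreal K * ennreal \<epsilon>)"
        by (rule mult_left_mono) simp
      then show ?thesis using K \<eta> \<epsilon> by (simp add: ennreal_mult mult.assoc)
    qed
    have small: "(1 + 1 / \<eta>) * K * \<epsilon> + A * \<epsilon> = \<eta>"
    proof -
      have "(1 + 1 / \<eta>) * K * \<epsilon> + A * \<epsilon> = L * \<epsilon>" by (simp only: L_def distrib_right)
      then show ?thesis using L by (simp add: \<epsilon>_def)
    qed
    have nonneg: "0 \<le> (1 + 1 / \<eta>) * K * \<epsilon>" "0 \<le> A * \<epsilon>" using K \<eta> \<epsilon> AB by simp_all
    have "ennreal A * ?n c = ennreal A * ?n c1 + ennreal A * ?n c2"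
      by (simp only: n_split distrib_left)
    also have "\<dots> \<le> (ennreal (1 + \<eta>) * sampling_sum g \<Lambda> a c + ennreal (1 + 1 / \<eta>) * sampling_sum g \<Lambda> a c3)
        + ennreal A * ennreal \<epsilon>"
    proof (intro add_mono mult_left_mono n2)
      have "ennreal A * ?n c1 \<le> sampling_sum g \<Lambda> a c1" using f1 by (simp add: c1_def)
      also have "\<dots> \<le> ennreal (1 + \<eta>) * sampling_sum g \<Lambda> a c + ennreal (1 + 1 / \<eta>) * sampling_sum g \<Lambda> a c3"
        unfolding c1 by (intro sampling_sum_add_le \<eta> shift_series_add[OF W c fin(3)])
      finally show "ennreal A * ?n c1 \<le> ennreal (1 + \<eta>) * sampling_sum g \<Lambda> a c + ennreal (1 + 1 / \<eta>) * sampling_sum g \<Lambda> a c3" .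
    qed simp
    also have "\<dots> \<le> (ennreal (1 + \<eta>) * sampling_sum g \<Lambda> a c + ennreal ((1 + 1 / \<eta>) * K * \<epsilon>)) + ennreal (A * \<epsilon>)"
      using err[of c3] n2 AB \<epsilon> by (intro add_mono order_refl) (simp_all add: n3 ennreal_mult)
    also have "\<dots> = ennreal (1 + \<eta>) * sampling_sum g \<Lambda> a c + ennreal \<eta> * 1"
      using nonneg by (simp add: add.assoc small flip: ennreal_plus)
    finally have 1: "ennreal A * ?n c \<le> ennreal (1 + \<eta>) * sampling_sum g \<Lambda> a c + ennreal \<eta> * 1" .
    have "sampling_sum g \<Lambda> a c \<le> ennreal (1 + \<eta>) * sampling_sum g \<Lambda> a c1 + ennreal (1 + 1 / \<eta>) * sampling_sum g \<Lambda> a c2"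
    proof (intro sampling_sum_add_le \<eta>)
      fix l
      show "shift_series g c (l + a) = shift_series g c1 (l + a) + shift_series g c2 (l + a)"
        by (subst c_eq) (rule shift_series_add[OF W fin(1,2)])
    qed
    also have "\<dots> \<le> ennreal (1 + \<eta>) * (ennreal B * ?n c) + ennreal \<eta>"
    proof (intro add_mono mult_left_mono)
      have "sampling_sum g \<Lambda> a c1 \<le> ennreal B * ?n c1" using f1 by (simp add: c1_def)
      also have "\<dots> \<le> ennreal B * ?n c" by (intro mult_left_mono) (simp_all add: n_split)
      finally show "sampling_sum g \<Lambda> a c1 \<le> ennreal B * ?n c" .
      have "ennreal ((1 + 1 / \<eta>) * K * \<epsilon>) \<le> ennreal \<eta>" using small nonneg by (intro ennreal_leI) linarith
      then show "ennreal (1 + 1 / \<eta>) * sampling_sum g \<Lambda> a c2 \<le> ennreal \<eta>" using err[OF n2] by (rule order_trans[rotated])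
    qed simp
    finally have 2: "sampling_sum g \<Lambda> a c \<le> ennreal (1 + \<eta>) * (ennreal B * ?n c) + ennreal \<eta> * 1" by simp
    show ?thesis using 1 2 by blast
  qed
  show ?thesis
    unfolding uniform_sampling_bounds_def sampling_bounds_iff[OF \<Lambda>] lower_bound_def upper_bound_def
  proof (intro ballI conjI AB allI impI)
    fix a :: real and c :: "int \<Rightarrow> complex"
    assume a: "a \<in> {0..<1}" and c: "sq_norm (count_space UNIV) c < \<infinity>"
    show "ennreal A * sq_norm (count_space UNIV) c \<le> sampling_sum g \<Lambda> a c"
      by (rule ennreal_le_of_perturbation[OF sampling_sum_finite[OF W sep c], of 1]) (use key[OF a c] in auto)
    have "ennreal B * sq_norm (count_space UNIV) c < \<infinity>" using c by (simp add: ennreal_mult_less_top)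
    then show "sampling_sum g \<Lambda> a c \<le> ennreal B * sq_norm (count_space UNIV) c"
      by (rule ennreal_le_of_perturbation[of _ 1]) (use key[OF a c] in auto)
  qed
qed

section \<open>Compactness: from pointwise to uniform bounds\<close>

lemma lower_bound_periodic:
  assumes "lower_bound g \<Lambda> x A"
  shows "lower_bound g \<Lambda> (x + 1) A"
  unfolding lower_bound_def
proof (intro allI impI)
  fix c :: "int \<Rightarrow> complex" assume c: "sq_norm (count_space UNIV) c < \<infinity>"
  \<comment> \<open>Increasing the translation by 1 has the same effect as shifting the sequence by
    one index, and the shift preserves the norm.\<close>
  let ?d = "\<lambda>k. c (k + 1)"
  have bij: "bij_betw (\<lambda>k::int. k + 1) UNIV UNIV" by (rule bij_betwI[where g="\<lambda>k. k - 1"]) auto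
  have n: "sq_norm (count_space UNIV) ?d = sq_norm (count_space UNIV) c"
    unfolding sq_norm_def
    using nn_integral_bij_count_space[OF bij, of "\<lambda>k. ennreal ((cmod (c k))\<^sup>2)"] by simp
  have "shift_series g ?d (l + x) = shift_series g c (l + (x + 1))" for l
    using infsum_reindex_bij_betw[OF bij, of "\<lambda>k. c k * g (l + (x + 1) - of_int k)"]
    by (simp add: shift_series_def add_diff_eq)
  then have s: "sampling_sum g \<Lambda> x ?d = sampling_sum g \<Lambda> (x + 1) c" by (simp add: sampling_sum_def)
  have "ennreal A * sq_norm (count_space UNIV) ?d \<le> sampling_sum g \<Lambda> x ?d"
    using assms c n unfolding lower_bound_def by (metis (no_types))
  then show "ennreal A * sq_norm (count_space UNIV) c \<le> sampling_sum g \<Lambda> (x + 1) c"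
    unfolding n s .
qed

text \<open>The best lower bound depends continuously on the translation, so compactness of the unit
  interval makes it uniform.\<close>

lemma uniform_of_pointwise_sampling_bounds:
  assumes g: "g \<in> wiener_space" and sep: "separated_by N \<Lambda>"
    and pt: "\<And>x. x \<in> {0..<1} \<Longrightarrow> \<exists>A B. sampling_bounds g \<Lambda> x A B"
  shows "\<exists>A B. uniform_sampling_bounds g \<Lambda> A B"
proof -
  obtain W where W: "amalgam_le g W" using wiener_space_amalgam[OF g] by blast
  note \<Lambda> = separated_by_countable[OF sep]
  have "\<exists>A>0. lower_bound g \<Lambda> x A" if "x \<in> {0..1}" for x
  proof (cases "x = 1")
    \<comment> \<open>Compactness needs the closed interval, while the hypothesis stops short of 1;
      the bound at 0 is carried over by periodicity.\<close>
    case True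
    obtain A B where "sampling_bounds g \<Lambda> 0 A B" using pt[of 0] by auto
    then have "A > 0" "lower_bound g \<Lambda> (0 + 1) A"
      by (auto simp: sampling_bounds_iff[OF \<Lambda>] simp del: add_0 intro: lower_bound_periodic)
    then show ?thesis using True by auto
  next
    case False
    then show ?thesis using pt[of x] that by (auto simp: sampling_bounds_iff[OF \<Lambda>])
  qed
  then obtain A where A: "\<And>x. x \<in> {0..1} \<Longrightarrow> A x > 0" "\<And>x. x \<in> {0..1} \<Longrightarrow> lower_bound g \<Lambda> x (A x)"
    by metis
  have "\<exists>\<delta>>0. \<forall>y. \<bar>x - y\<bar> < \<delta> \<longrightarrow> lower_bound g \<Lambda> y (A x / 4)" if x: "x \<in> {0..1}" for x
  proof -
    \<comment> \<open>With \<open>\<eta> \<le> A x / 2\<close> at most half of the lower bound is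
      lost to the error term, and \<open>1 + \<eta> \<le> 2\<close> halves the rest; this is the
      origin of \<open>A x / 4\<close>.\<close>
    define \<eta> where "\<eta> = min 1 (A x / 2)"
    have \<eta>: "0 < \<eta>" "\<eta> \<le> 1" "\<eta> \<le> A x / 2" using A(1)[OF x] by (auto simp: \<eta>_def)
    obtain \<delta> where \<delta>: "0 < \<delta>" and near: "\<And>x y c. \<bar>x - y\<bar> < \<delta> \<Longrightarrow> sq_norm (count_space UNIV) c < \<infinity> \<Longrightarrow>
      sampling_sum g \<Lambda> x c \<le> ennreal (1 + \<eta>) * sampling_sum g \<Lambda> y c + ennreal \<eta> * sq_norm (count_space UNIV) c"
      using sampling_sum_continuous[OF g sep \<eta>(1)] by metis
    have "lower_bound g \<Lambda> y (A x / 4)" if y: "\<bar>x - y\<bar> < \<delta>" for y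
      unfolding lower_bound_def
    proof (intro allI impI)
      fix c :: "int \<Rightarrow> complex" assume c: "sq_norm (count_space UNIV) c < \<infinity>"
      obtain n where n: "sq_norm (count_space UNIV) c = ennreal n" "0 \<le> n"
        using c by (metis ennreal_cases infinity_ennreal_def less_irrefl)
      obtain s where s: "sampling_sum g \<Lambda> y c = ennreal s" "0 \<le> s"
        using sampling_sum_finite[OF W sep c] by (metis ennreal_cases infinity_ennreal_def less_irrefl)
      have "ennreal (A x) * ennreal n \<le> ennreal (1 + \<eta>) * ennreal s + ennreal \<eta> * ennreal n"
        using A(2)[OF x] near[OF y c] c unfolding lower_bound_def n(1)[symmetric] s(1)[symmetric]
        by (blast intro: order_trans)
      then have "ennreal (A x * n) \<le> ennreal ((1 + \<eta>) * s + \<eta> * n)"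
        using n s \<eta> A(1)[OF x] by (simp add: ennreal_mult)
      then have "A x * n \<le> (1 + \<eta>) * s + \<eta> * n"
        using n s \<eta> by (subst (asm) ennreal_le_iff) auto
      moreover have "\<eta> * s \<le> 1 * s" "\<eta> * n \<le> A x / 2 * n" using \<eta> n s by (intro mult_right_mono; simp)+
      ultimately have "A x / 4 * n \<le> s" by (simp add: algebra_simps)
      then show "ennreal (A x / 4) * sq_norm (count_space UNIV) c \<le> sampling_sum g \<Lambda> y c"
        unfolding n s using n A(1)[OF x] by (simp add: ennreal_mult[symmetric] ennreal_leI)
    qed
    with \<delta> show ?thesis by blast
  qed
  then obtain \<delta> where \<delta>: "\<And>x. x \<in> {0..1} \<Longrightarrow> \<delta> x > 0"
    "\<And>x y. x \<in> {0..1} \<Longrightarrow> \<bar>x - y\<bar> < \<delta> x \<Longrightarrow> lower_bound g \<Lambda> y (A x / 4)" by metis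
  have "{0..1} \<subseteq> (\<Union>x\<in>{0..1}. ball x (\<delta> x))" using \<delta>(1) by force
  then obtain C where C: "C \<subseteq> {0..1}" "finite C" "{0..1} \<subseteq> (\<Union>x\<in>C. ball x (\<delta> x))"
    using compactE_image[of "{0..1::real}" "{0..1}" "\<lambda>x. ball x (\<delta> x)"] by (metis compact_Icc open_ball)
  have "(0::real) \<in> {0..1}" by simp
  then have C0: "C \<noteq> {}" using C(3) by blast
  define A0 where "A0 = Min ((\<lambda>x. A x / 4) ` C)"
  have A0: "0 < A0" unfolding A0_def using C C0 A(1) by (subst Min_gr_iff) auto
  have low: "lower_bound g \<Lambda> y A0" if y: "y \<in> {0..1}" for y
  proof -
    obtain x where x: "x \<in> C" "y \<in> ball x (\<delta> x)" using C(3) y by blast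
    have le: "A0 \<le> A x / 4" unfolding A0_def using C x by (intro Min_le) auto
    have "lower_bound g \<Lambda> y (A x / 4)" using x C by (intro \<delta>(2)) (auto simp: dist_real_def)
    then show ?thesis
      unfolding lower_bound_def using le by (meson ennreal_leI mult_right_mono order_trans zero_le)
  qed
  \<comment> \<open>Schur's constant serves all translations at once; adding 1 makes it
    positive.\<close>
  define B where "B = real N * W\<^sup>2 + 1"
  have "0 < B" by (simp add: B_def add_nonneg_pos)
  moreover have "upper_bound g \<Lambda> x B" for x
    unfolding upper_bound_def
  proof (intro allI impI)
    fix c
    have "sampling_sum g \<Lambda> x c \<le> ennreal (real N * W\<^sup>2) * sq_norm (count_space UNIV) c"
      by (rule sampling_sum_le[OF W sep])
    also have "\<dots> \<le> ennreal B * sq_norm (count_space UNIV) c"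
      by (intro mult_right_mono ennreal_leI) (simp_all add: B_def)
    finally show "sampling_sum g \<Lambda> x c \<le> ennreal B * sq_norm (count_space UNIV) c" .
  qed
  ultimately have "uniform_sampling_bounds g \<Lambda> A0 B"
    using A0 low unfolding uniform_sampling_bounds_def sampling_bounds_iff[OF \<Lambda>] by auto
  then show ?thesis by blast
qed

section \<open>Existence of optimal constants\<close>

lemma ennreal_mult_cSup_le:
  assumes S: "S \<noteq> {}" "bdd_above S" and n: "n < \<infinity>"
    and le: "\<And>A. A \<in> S \<Longrightarrow> ennreal A * n \<le> s"
  shows "ennreal (Sup S) * n \<le> s"
proof (rule ennreal_le_epsilon)
  fix e :: real assume e: "0 < e"
  obtain n' where n': "n = ennreal n'" "0 \<le> n'" using n by (metis ennreal_cases infinity_ennreal_def less_irrefl)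
  define \<kappa> where "\<kappa> = e / (n' + 1)"
  have \<kappa>: "0 < \<kappa>" "\<kappa> * n' \<le> e" using e n' by (auto simp: \<kappa>_def field_simps)
  obtain A where A: "A \<in> S" "Sup S - \<kappa> < A"
    using less_cSup_iff[OF S, of "Sup S - \<kappa>"] \<kappa> by auto
  \<comment> \<open>A member of \<open>S\<close> may be negative, and \<open>ennreal\<close> sends
    negative reals to 0. Replacing \<open>A\<close> by \<open>max 0 A\<close> keeps its image and
    makes \<open>ennreal\<close> additive.\<close>
  have "ennreal (Sup S) * n \<le> ennreal (max 0 A + \<kappa>) * n"
    using A by (intro mult_right_mono ennreal_leI) auto
  also have "\<dots> = ennreal A * n + ennreal (\<kappa> * n')"
    using \<kappa> n' by (simp add: ennreal_plus distrib_right ennreal_mult max_def ennreal_neg)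
  also have "\<dots> \<le> s + ennreal e" using A \<kappa> by (intro add_mono le ennreal_leI) auto
  finally show "ennreal (Sup S) * n \<le> s + ennreal e" .
qed

lemma le_ennreal_mult_cInf:
  assumes S: "S \<noteq> {}" "bdd_below S" and S0: "\<And>B. B \<in> S \<Longrightarrow> 0 \<le> B" and n: "n < \<infinity>"
    and le: "\<And>B. B \<in> S \<Longrightarrow> s \<le> ennreal B * n"
  shows "s \<le> ennreal (Inf S) * n"
proof (rule ennreal_le_epsilon)
  fix e :: real assume e: "0 < e"
  obtain n' where n': "n = ennreal n'" "0 \<le> n'" using n by (metis ennreal_cases infinity_ennreal_def less_irrefl)
  define \<kappa> where "\<kappa> = e / (n' + 1)"
  have \<kappa>: "0 < \<kappa>" "\<kappa> * n' \<le> e" using e n' by (auto simp: \<kappa>_def field_simps)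
  obtain B where B: "B \<in> S" "B < Inf S + \<kappa>"
    using cInf_less_iff[OF S, of "Inf S + \<kappa>"] \<kappa> by auto
  have inf0: "0 \<le> Inf S" using S(1) S0 by (intro cInf_greatest)
  have "s \<le> ennreal B * n" by (rule le[OF B(1)])
  also have "\<dots> \<le> ennreal (Inf S + \<kappa>) * n" using B by (intro mult_right_mono ennreal_leI) auto
  also have "\<dots> = ennreal (Inf S) * n + ennreal (\<kappa> * n')"
    using \<kappa> n' inf0 by (simp add: distrib_right ennreal_mult)
  also have "\<dots> \<le> ennreal (Inf S) * n + ennreal e" using \<kappa> by (intro add_mono ennreal_leI) auto
  finally show "s \<le> ennreal (Inf S) * n + ennreal e" .
qed

text \<open>Admissible pairs form a product \<open>SA \<times> SB\<close>, since the two
  inequalities do not interact. Each member of \<open>SA\<close> lies below each member of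
  \<open>SB\<close>, so supremum and infimum exist, and both are attained because the inequalities
  pass to limits in the constant.\<close>

lemma optimal_uniform_sampling_bounds_exist:
  assumes \<Lambda>: "countable \<Lambda>" and unif: "uniform_sampling_bounds g \<Lambda> A B"
  shows "\<exists>A B. optimal_bounds (uniform_sampling_bounds g \<Lambda>) A B"
proof -
  define SA where "SA = {A. 0 < A \<and> (\<forall>x\<in>{0..<1}. lower_bound g \<Lambda> x A)}"
  define SB where "SB = {B. 0 < B \<and> (\<forall>x\<in>{0..<1}. upper_bound g \<Lambda> x B)}"
  have iff: "uniform_sampling_bounds g \<Lambda> A B \<longleftrightarrow> A \<in> SA \<and> B \<in> SB" for A B
    unfolding uniform_sampling_bounds_def sampling_bounds_iff[OF \<Lambda>] SA_def SB_def
    by (auto dest: bspec[of _ _ 0])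
  have AB: "A \<in> SA" "B \<in> SB" using unif by (simp_all add: iff)
  have le: "A' \<le> B'" if "A' \<in> SA" "B' \<in> SB" for A' B'
  proof -
    \<comment> \<open>A sequence of norm 1 is what makes the lower and the upper constant
      comparable.\<close>
    let ?c = "\<lambda>k::int. if k = 0 then 1 else 0 :: complex"
    have n: "sq_norm (count_space UNIV) ?c = 1"
      by (subst sq_norm_finite_support[of "{0}"]) auto
    have "lower_bound g \<Lambda> 0 A'" "upper_bound g \<Lambda> 0 B'" "0 < B'" using that by (auto simp: SA_def SB_def)
    moreover have "sq_norm (count_space UNIV) ?c < \<infinity>" using n by simp
    ultimately have "ennreal A' * sq_norm (count_space UNIV) ?c \<le> sampling_sum g \<Lambda> 0 ?c"
      "sampling_sum g \<Lambda> 0 ?c \<le> ennreal B' * sq_norm (count_space UNIV) ?c"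
      unfolding lower_bound_def upper_bound_def by blast+
    then have "ennreal A' * sq_norm (count_space UNIV) ?c \<le> ennreal B' * sq_norm (count_space UNIV) ?c"
      by (rule order_trans)
    then show ?thesis using that by (simp add: n SB_def)
  qed
  have bA: "bdd_above SA" and bB: "bdd_below SB" using le AB by (auto intro!: bdd_aboveI bdd_belowI)
  have "Sup SA \<in> SA"
  proof -
    have "0 < A" using AB by (simp add: SA_def)
    then have "0 < Sup SA" using cSup_upper[OF AB(1) bA] by simp
    moreover have "lower_bound g \<Lambda> x (Sup SA)" if "x \<in> {0..<1}" for x
      unfolding lower_bound_def
    proof (intro allI impI)
      fix c :: "int \<Rightarrow> complex" assume c: "sq_norm (count_space UNIV) c < \<infinity>"
      show "ennreal (Sup SA) * sq_norm (count_space UNIV) c \<le> sampling_sum g \<Lambda> x c"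
        using AB bA c that by (intro ennreal_mult_cSup_le) (auto simp: SA_def lower_bound_def)
    qed
    ultimately show ?thesis by (simp add: SA_def)
  qed
  moreover have "Inf SB \<in> SB"
  proof -
    have "A \<le> Inf SB" using AB le by (intro cInf_greatest) auto
    moreover have "0 < A" using AB by (simp add: SA_def)
    ultimately have "0 < Inf SB" by simp
    moreover have "upper_bound g \<Lambda> x (Inf SB)" if "x \<in> {0..<1}" for x
      unfolding upper_bound_def
    proof (intro allI impI)
      fix c :: "int \<Rightarrow> complex" assume c: "sq_norm (count_space UNIV) c < \<infinity>"
      show "sampling_sum g \<Lambda> x c \<le> ennreal (Inf SB) * sq_norm (count_space UNIV) c"
        using AB bB c that by (intro le_ennreal_mult_cInf) (auto simp: SB_def upper_bound_def)
    qed
    ultimately show ?thesis by (simp add: SB_def)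
  qed
  ultimately have "optimal_bounds (uniform_sampling_bounds g \<Lambda>) (Sup SA) (Inf SB)"
    unfolding optimal_bounds_def iff using bA bB by (auto intro: cSup_upper cInf_lower)
  then show ?thesis by blast
qed

theorem theorem2p3:
  fixes g :: "real \<Rightarrow> complex" and \<Lambda> :: "real set"
  assumes "g \<in> wiener_space"
    and "stable_integer_shifts g"
    and "relatively_separated \<Lambda>"
  shows "((\<exists>A B. gabor_frame_bounds g \<Lambda> A B) \<longleftrightarrow> (\<forall>x\<in>{0..<1}. \<exists>A B. sampling_bounds g \<Lambda> x A B)) \<and>
    ((\<forall>x\<in>{0..<1}. \<exists>A B. sampling_bounds g \<Lambda> x A B) \<longleftrightarrow> (\<exists>A B. uniform_sampling_bounds g \<Lambda> A B)) \<and>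
    ((\<exists>A B. uniform_sampling_bounds g \<Lambda> A B) \<longleftrightarrow> (\<exists>A B. Zak_bounds g \<Lambda> A B)) \<and>
    ((\<exists>A B. gabor_frame_bounds g \<Lambda> A B) \<longrightarrow>
      (\<exists>A B. optimal_bounds (gabor_frame_bounds g \<Lambda>) A B \<and>
             optimal_bounds (uniform_sampling_bounds g \<Lambda>) A B \<and>
             optimal_bounds (Zak_bounds g \<Lambda>) A B))"
proof -
  obtain N where sep: "separated_by N \<Lambda>"
    using assms(3) by (auto simp: relatively_separated_def separated_by_def)
  note \<Lambda> = separated_by_countable[OF sep]
  have gabor: "gabor_frame_bounds g \<Lambda> = uniform_sampling_bounds g \<Lambda>"
    using gabor_frame_bounds_of_uniform[OF assms(1) sep] uniform_of_gabor_frame_bounds[OF assms(1) sep]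
    by (intro ext) blast
  have zak: "Zak_bounds g \<Lambda> = uniform_sampling_bounds g \<Lambda>"
    using Zak_bounds_of_uniform[OF assms(1) sep] uniform_of_Zak_bounds[OF assms(1) sep]
    by (intro ext) blast
  have pointwise: "(\<forall>x\<in>{0..<1}. \<exists>A B. sampling_bounds g \<Lambda> x A B) \<longleftrightarrow> (\<exists>A B. uniform_sampling_bounds g \<Lambda> A B)"
  proof
    assume "\<forall>x\<in>{0..<1}. \<exists>A B. sampling_bounds g \<Lambda> x A B"
    then show "\<exists>A B. uniform_sampling_bounds g \<Lambda> A B"
      by (intro uniform_of_pointwise_sampling_bounds[OF assms(1) sep]) blast
  qed (unfold uniform_sampling_bounds_def, blast)
  show ?thesis
    unfolding gabor zak pointwise using optimal_uniform_sampling_bounds_exist[OF \<Lambda>] by blast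
qed

end
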